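(* Let $G$ be a finite group, $V$ a $\mathbb{C}G$-module of finite dimension $n$, and $g,h\in G$. Let $B_g=\{w_1,\dots,w_n\}$ and $B_h=\{v_1,\dots,v_n\}$ be bases of $V$ consisting of eigenvectors of $g$ and of $h$ respectively, and let $M=(a_{ij})$ be the matrix with $v_i=a_{1i}w_1+\cdots+a_{ni}w_n$ for all $i$. Write ${}^gw_i=\epsilon_iw_i$ and $g=s_1\cdots s_n$, where $s_i\in\mathrm{GL}(V)$ satisfies $s_i(w_i)=\epsilon_iw_i$ and $s_i(w_j)=w_j$ for $j\ne i$. Let $$\alpha=f_g\overline g\otimes dw_J\in H^p_g,\ J=(j_1<\cdots<j_p),\qquad \beta=f'_h\overline h\otimes dv_L\in H^q_h,\ L=(l_1<\cdots<l_q).$$ Then $\alpha\,\overline\circ\,\beta$ (formed with respect to $B_g$ and $B_h$) is given as an element of $C^{p+q-1}_{gh}$ by the following formula: for $m=p+q-1$ and $I=(i_1<\cdots<i_m)$, $$(\alpha\,\overline\circ\,\beta)(v_{i_1}\wedge\cdots\wedge v_{i_m})=\sum_{1\le k\le p}(-1)^{\nu(k)}\det(M_{J_k;I-L})\ {}^{s_1\cdots s_{j_k-1}}(\partial_{j_k}f'_h)\ f_g\ \overline{gh},$$ where $\det(M_{*;I-L})=0$ for $L\not\subset I$, $J_k=(j_1,\dots,j_{k-1},j_{k+1},\dots,j_p)$, $\partial_i=\partial_{w_i,\epsilon_i}$, and $\nu(k)=1-q-k+\lambda(1)+\cdots+\lambda(q)-\binom q2$ for $\lambda$ defined by $l_s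=i_{\lambda(s)}$.
   Context: **Setting.** $S(V)$ is the symmetric algebra and $A=S(V)\#G$ the skew group algebra: $S(V)\otimes\mathbb{C}G$ (write $s\overline g$ for $s\otimes g$) with $(r\overline g)(s\overline h)=r({}^gs)\overline{gh}$. Fix a $G$-invariant Hermitian inner product on $V$; $V^g=\{v:{}^gv=v\}$, $(V^g)^\perp=\mathrm{im}(1-g)$. Via $V=V^g\oplus(V^g)^\perp$ regard $(V^g)^*,((V^g)^\perp)^*\subseteq V^*$. $C^p_g=S(V)\overline g\otimes\bigwedge^pV^*$, identified with $\mathrm{Hom}_{\mathbb C}(\bigwedge^pV,S(V)\overline g)$ so that $(x_1^*\wedge\cdots\wedge x_p^* )(y_1\wedge\cdots\wedge y_p)=\det(x_i^*(y_j))$; $H^p_g=S(V^g)\overline g\otimes\bigwedge^{p-\mathrm{codim}V^g}(V^g)^*\otimes\bigwedge^{\mathrm{codim}V^g}((V^g)^\perp)^*\subseteq C^p_g$ (negative exterior powers are $0$). For a basis $x_1,\dots,x_n$ of $V$ with dual basis $x_i^*$ and a multi-index $I=(i_1,\dots,i_m)$, $dx_I=x_{i_1}^*\wedge\cdots\wedge x_{i_m}^*$. For ordered subsets $I,J$ of $\{1,\dots,n\}$, $M_{I;J}$ is the submatrix of $M$ with rows indexed by $I$ and columns indexed by $J$; $I-L$ is $I$ with the entries of $L$ removed. **Quantum partial derivatives and the map $\overline{\Upsilon}$.** For a basis $v_1,\dots,v_n$ of $V$ and $\epsilon\ne1$, $\partial_{v_i,\epsilon}(f)=\dfrac{f-{}^sf}{v_i-{}^sv_i}$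 on $S(V)$, where $s=\mathrm{diag}(1,\dots,\epsilon,\dots,1)$ in this basis ($\epsilon$ in slot $i$); $\partial_{v_i,1}=\partial/\partial v_i$. For $g\in G$ and an eigenbasis $B=\{v_1,\dots,v_n\}$, ${}^gv_i=\epsilon_iv_i$, let $s_i\in\mathrm{GL}(V)$ fix $v_j$ ($j\ne i$) and send $v_i\mapsto\epsilon_iv_i$, and $\partial_i=\partial_{v_i,\epsilon_i}$. The linear map $\overline{\Upsilon}_{g,B}:C^p_g\to\mathrm{Hom}_{\mathbb C}(S(V)^{\otimes p},S(V))$ is given on $f_g\overline g\otimes v_{j_1}^*\wedge\cdots\wedge v_{j_p}^*$, $j_1<\cdots<j_p$, by $f_1\otimes\cdots\otimes f_p\mapsto\Big(\prod_{k=1}^p{}^{s_1s_2\cdots s_{j_k-1}}(\partial_{j_k}f_k)\Big)f_g$. **The operation $\overline\circ$.** For $\alpha\in C^p_g$, $\beta\in C^q_h$, eigenbases $B_1$ of $g$ and $B_2$ of $h$, any basis $v_1,\dots,v_n$ of $V$, and $m=p+q-1$, $$\alpha\,\overline\circ\,\beta=\sum_{I=(i_1,\dots,i_m),\ 1\le k\le p}(-1)^{(q-1)(k-1)}\,\overline{\Upsilon}_{g,B_1}(\alpha)\big(v_{i_1}\otimes\cdots\otimes v_{i_{k-1}}\otimes f_h^{(i_k)}\otimes{}^hv_{i_{k+q}}\otimes\cdots\otimes{}^hv_{i_m}\big)\,\overline{gh}\otimes dv_I,$$ summed over all multi-indices $I\in\{1,\dots,n\}^m$ (not only increasing ones), where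 $f_h^{(i_k)}=\overline{\Upsilon}_{h,B_2}(\beta)(v_{i_k}\otimes\cdots\otimes v_{i_{k+q-1}})$. In the theorem $B_1=B_g$, $B_2=B_h$. *)

theory Defs
  imports
    Complex_Main
    "HOL-Library.Poly_Mapping"
    "HOL-Algebra.Group"
    "Jordan_Normal_Form.Determinant"
begin

class complex_vector = ab_group_add +
  fixes scaleC :: "complex \<Rightarrow> 'a \<Rightarrow> 'a"  (infixr \<open>*\<^sub>C\<close> 75)
  assumes scaleC_add_right: "a *\<^sub>C (x + y) = a *\<^sub>C x + a *\<^sub>C y"
    and scaleC_add_left: "(a + b) *\<^sub>C x = a *\<^sub>C x + b *\<^sub>C x"
    and scaleC_scaleC: "a *\<^sub>C b *\<^sub>C x = (a * b) *\<^sub>C x"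
    and scaleC_one: "1 *\<^sub>C x = x"

global_interpretation cvec: vector_space "scaleC :: complex \<Rightarrow> 'a \<Rightarrow> 'a::complex_vector"
  by unfold_locales (rule scaleC_add_right scaleC_add_left scaleC_scaleC scaleC_one)+

abbreviation clinear :: "('a::complex_vector \<Rightarrow> 'b::complex_vector) \<Rightarrow> bool" where
  "clinear \<equiv> Vector_Spaces.linear scaleC scaleC"

text \<open>A family indexed by \<open>1, \<dots>, n\<close> that is a basis (so that \<open>dim V = n\<close>), and its dual basis.\<close>

definition is_basis :: "nat \<Rightarrow> (nat \<Rightarrow> 'v::complex_vector) \<Rightarrow> bool" where
  "is_basis n x \<longleftrightarrow> inj_on x {1..n} \<and> cvec.independent (x ` {1..n}) \<and> cvec.span (x ` {1..n}) = UNIV"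

definition dual :: "nat \<Rightarrow> (nat \<Rightarrow> 'v::complex_vector) \<Rightarrow> nat \<Rightarrow> 'v \<Rightarrow> complex" where
  "dual n x i y = cvec.representation (x ` {1..n}) y (x i)"


text \<open>
  \<open>S(V)\<close> is the free commutative algebra on the set \<open>V\<close>, that is, the polynomial ring with one
  variable for each vector, modulo the ideal that makes the map from \<open>V\<close> to the variables linear.
  The ideal generated by a set \<open>R\<close> is the span of \<open>R\<close> in the ring as a module over itself.
\<close>

type_synonym 'v free_alg = "('v \<Rightarrow>\<^sub>0 nat) \<Rightarrow>\<^sub>0 complex"

definition free_var :: "'v \<Rightarrow> 'v free_alg" where
  "free_var v = Poly_Mapping.single (Poly_Mapping.single v 1) 1"

definition free_const :: "complex \<Rightarrow> 'v free_alg" where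
  "free_const c = Poly_Mapping.single 0 c"

definition lin_rels :: "'v::complex_vector free_alg set" where
  "lin_rels = {free_var (u + v) - free_var u - free_var v | u v. True}
     \<union> {free_var (c *\<^sub>C v) - free_const c * free_var v | c v. True}"

definition lin_ideal :: "'v::complex_vector free_alg set" where
  "lin_ideal = Modules.module.span (*) lin_rels"

lemma module_times: "Modules.module ((*) :: 'a::comm_ring_1 \<Rightarrow> 'a \<Rightarrow> 'a)"
  by unfold_locales (auto simp: algebra_simps)

lemma lin_ideal_0: "0 \<in> lin_ideal"
  unfolding lin_ideal_def by (rule Modules.module.span_zero[OF module_times])

lemma lin_ideal_add: "x \<in> lin_ideal \<Longrightarrow> y \<in> lin_ideal \<Longrightarrow> x + y \<in> lin_ideal"
  unfolding lin_ideal_def by (rule Modules.module.span_add[OF module_times])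

lemma lin_ideal_mult: "x \<in> lin_ideal \<Longrightarrow> a * x \<in> lin_ideal"
  unfolding lin_ideal_def by (rule Modules.module.span_scale[OF module_times])

lemma lin_ideal_neg: "x \<in> lin_ideal \<Longrightarrow> - x \<in> lin_ideal"
  unfolding lin_ideal_def by (rule Modules.module.span_neg[OF module_times])

lemma lookup_mult_0:
  fixes a b :: "'v free_alg"
  shows "Poly_Mapping.lookup (a * b) 0 = Poly_Mapping.lookup a 0 * Poly_Mapping.lookup b 0"
proof -
  have z: "(0 = l + q) \<longleftrightarrow> (l = 0 \<and> q = 0)" for l q :: "'v \<Rightarrow>\<^sub>0 nat"
    by (metis add_eq_0_iff_both_eq_0 lookup_add lookup_zero poly_mapping_eqI add_0)
  have "Poly_Mapping.lookup (a * b) 0 =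
      (\<Sum>l. Poly_Mapping.lookup a l * (\<Sum>q. Poly_Mapping.lookup b q when (l = 0 \<and> q = 0)))"
    by (simp add: times_poly_mapping.rep_eq prod_fun_def z)
  also have "\<dots> = (\<Sum>l. (Poly_Mapping.lookup a l * Poly_Mapping.lookup b 0) when l = 0)"
    by (rule Sum_any.cong) (auto simp: when_def)
  finally show ?thesis by simp
qed

lemma lookup_free_var_0: "Poly_Mapping.lookup (free_var v) 0 = 0"
proof -
  have "Poly_Mapping.single v (1 :: nat) \<noteq> 0"
    by (metis lookup_single_eq lookup_zero zero_neq_one)
  then show ?thesis by (simp add: free_var_def lookup_single_not_eq)
qed

lemma one_notin_lin_ideal: "1 \<notin> lin_ideal"
proof -
  have "Poly_Mapping.lookup x 0 = 0" if "x \<in> lin_ideal" for x :: "'v::complex_vector free_alg"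
    using that unfolding lin_ideal_def
  proof (induction rule: module.span_induct_alt[OF module_times, consumes 1])
    case 1
    then show ?case by simp
  next
    case (2 c r y)
    then have "Poly_Mapping.lookup r 0 = 0"
      by (auto simp: lin_rels_def lookup_minus lookup_mult_0 lookup_free_var_0)
    with 2 show ?case by (simp add: lookup_add lookup_mult_0)
  qed
  then show ?thesis by (metis lookup_one_zero zero_neq_one)
qed

quotient_type (overloaded) 'v sym_alg = "'v::complex_vector free_alg" / "\<lambda>f g. f - g \<in> lin_ideal"
proof (rule equivpI)
  show "reflp (\<lambda>f g. f - g \<in> (lin_ideal :: 'v free_alg set))"
    by (simp add: reflp_def lin_ideal_0)
  show "symp (\<lambda>f g. f - g \<in> (lin_ideal :: 'v free_alg set))"
    using lin_ideal_neg by (fastforce simp: symp_def)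
  show "transp (\<lambda>f g. f - g \<in> (lin_ideal :: 'v free_alg set))"
    using lin_ideal_add by (fastforce simp: transp_def)
qed

instantiation sym_alg :: (complex_vector) comm_ring_1
begin

lift_definition zero_sym_alg :: "'a sym_alg" is 0 .
lift_definition one_sym_alg :: "'a sym_alg" is 1 .
lift_definition plus_sym_alg :: "'a sym_alg \<Rightarrow> 'a sym_alg \<Rightarrow> 'a sym_alg" is "(+)"
  using lin_ideal_add by (fastforce simp: algebra_simps)
lift_definition uminus_sym_alg :: "'a sym_alg \<Rightarrow> 'a sym_alg" is uminus
  using lin_ideal_neg by fastforce
lift_definition minus_sym_alg :: "'a sym_alg \<Rightarrow> 'a sym_alg \<Rightarrow> 'a sym_alg" is "(-)"
proof -
  fix a b c d :: "'a free_alg"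
  assume "a - b \<in> lin_ideal" "c - d \<in> lin_ideal"
  then have "(a - b) + - (c - d) \<in> lin_ideal" by (intro lin_ideal_add lin_ideal_neg)
  then show "a - c - (b - d) \<in> lin_ideal" by (simp add: algebra_simps)
qed
lift_definition times_sym_alg :: "'a sym_alg \<Rightarrow> 'a sym_alg \<Rightarrow> 'a sym_alg" is "(*)"
proof -
  fix a b c d :: "'a free_alg"
  assume "a - b \<in> lin_ideal" "c - d \<in> lin_ideal"
  then have "c * (a - b) + b * (c - d) \<in> lin_ideal" by (intro lin_ideal_add lin_ideal_mult)
  then show "a * c - b * d \<in> lin_ideal" by (simp add: algebra_simps)
qed

instance
proof
  show "(0 :: 'a sym_alg) \<noteq> 1"
    by transfer (use lin_ideal_neg one_notin_lin_ideal in fastforce)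
qed (transfer; simp add: algebra_simps lin_ideal_0)+

end

instantiation sym_alg :: (complex_vector) complex_vector
begin

lift_definition scaleC_sym_alg :: "complex \<Rightarrow> 'a sym_alg \<Rightarrow> 'a sym_alg"
  is "\<lambda>c f. free_const c * f"
  using lin_ideal_mult by (fastforce simp: algebra_simps)

instance
proof
  have c: "free_const (a + b) = free_const a + (free_const b :: 'v free_alg)"
          "free_const (a * b) = free_const a * (free_const b :: 'v free_alg)"
          "free_const 1 = (1 :: 'v free_alg)" for a b
    by (simp_all add: free_const_def single_add mult_single)
  fix a b :: complex and x y :: "'a sym_alg"
  show "a *\<^sub>C (x + y) = a *\<^sub>C x + a *\<^sub>C y"
    by transfer (simp add: algebra_simps lin_ideal_0)
  show "(a + b) *\<^sub>C x = a *\<^sub>C x + b *\<^sub>C x"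
    by transfer (simp add: c algebra_simps lin_ideal_0)
  show "a *\<^sub>C b *\<^sub>C x = (a * b) *\<^sub>C x"
    by transfer (simp add: c algebra_simps lin_ideal_0)
  show "1 *\<^sub>C x = x"
    by transfer (simp add: c lin_ideal_0)
qed

end

lift_definition sym_incl :: "'v::complex_vector \<Rightarrow> 'v sym_alg" is free_var .

text \<open>The action on \<open>S(V)\<close>, by algebra automorphisms, of a linear transformation of \<open>V\<close>.\<close>

definition sym_map :: "('v \<Rightarrow> 'v) \<Rightarrow> 'v::complex_vector sym_alg \<Rightarrow> 'v sym_alg" where
  "sym_map T = (THE \<phi>. clinear \<phi> \<and> \<phi> 1 = 1 \<and> (\<forall>f1 f2. \<phi> (f1 * f2) = \<phi> f1 * \<phi> f2)
     \<and> (\<forall>v. \<phi> (sym_incl v) = sym_incl (T v)))"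

text \<open>The subalgebra generated by \<open>U\<close>; for a subspace \<open>U\<close> of \<open>V\<close> it is \<open>S(U)\<close>.\<close>

inductive_set sym_sub :: "'v::complex_vector set \<Rightarrow> 'v sym_alg set" for U where
  one: "1 \<in> sym_sub U"
| incl: "u \<in> U \<Longrightarrow> sym_incl u \<in> sym_sub U"
| scale: "f \<in> sym_sub U \<Longrightarrow> c *\<^sub>C f \<in> sym_sub U"
| add: "f1 \<in> sym_sub U \<Longrightarrow> f2 \<in> sym_sub U \<Longrightarrow> f1 + f2 \<in> sym_sub U"
| mult: "f1 \<in> sym_sub U \<Longrightarrow> f2 \<in> sym_sub U \<Longrightarrow> f1 * f2 \<in> sym_sub U"


definition diag_slot :: "nat \<Rightarrow> (nat \<Rightarrow> 'v::complex_vector) \<Rightarrow> nat \<Rightarrow> complex \<Rightarrow> 'v \<Rightarrow> 'v" where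
  "diag_slot n x i e y = (\<Sum>j = 1..n. ((if j = i then e else 1) * dual n x j y) *\<^sub>C x j)"

definition partial :: "nat \<Rightarrow> (nat \<Rightarrow> 'v::complex_vector) \<Rightarrow> nat \<Rightarrow> 'v sym_alg \<Rightarrow> 'v sym_alg" where
  "partial n x i = (THE D. clinear D \<and> (\<forall>f1 f2. D (f1 * f2) = D f1 * f2 + f1 * D f2)
     \<and> (\<forall>j\<in>{1..n}. D (sym_incl (x j)) = (if j = i then 1 else 0)))"

text \<open>For \<open>e \<noteq> 1\<close> the quotient exists in \<open>S(V)\<close>, and it is unique since \<open>S(V)\<close> is a domain.\<close>

definition quantum_partial ::
  "nat \<Rightarrow> (nat \<Rightarrow> 'v::complex_vector) \<Rightarrow> nat \<Rightarrow> complex \<Rightarrow> 'v sym_alg \<Rightarrow> 'v sym_alg" where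
  "quantum_partial n x i e f =
     (if e = 1 then partial n x i f
      else (THE r. r * (sym_incl (x i) - sym_map (diag_slot n x i e) (sym_incl (x i)))
                   = f - sym_map (diag_slot n x i e) f))"

text \<open>The product \<open>s\<^sub>1 s\<^sub>2 \<cdots> s\<^bsub>j-1\<^esub>\<close> for the eigenvalues \<open>e 1, e 2, \<dots>\<close> on the basis \<open>x\<close>.\<close>

definition slot_prod ::
  "nat \<Rightarrow> (nat \<Rightarrow> 'v::complex_vector) \<Rightarrow> (nat \<Rightarrow> complex) \<Rightarrow> nat \<Rightarrow> 'v \<Rightarrow> 'v" where
  "slot_prod n x e j = foldr (\<circ>) (map (\<lambda>i. diag_slot n x i (e i)) [1..<j]) id"

definition eigenvalue :: "('v \<Rightarrow> 'v) \<Rightarrow> 'v::complex_vector \<Rightarrow> complex" where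
  "eigenvalue T x = (THE c. T x = c *\<^sub>C x)"

definition is_eigenbasis :: "nat \<Rightarrow> ('v \<Rightarrow> 'v) \<Rightarrow> (nat \<Rightarrow> 'v::complex_vector) \<Rightarrow> bool" where
  "is_eigenbasis n T x \<longleftrightarrow> is_basis n x \<and> (\<forall>i\<in>{1..n}. \<exists>c. T (x i) = c *\<^sub>C x i)"


definition CG_module :: "('g, 'b) monoid_scheme \<Rightarrow> ('g \<Rightarrow> 'v::complex_vector \<Rightarrow> 'v) \<Rightarrow> bool" where
  "CG_module G \<rho> \<longleftrightarrow> (\<forall>g\<in>carrier G. clinear (\<rho> g)) \<and> \<rho> \<one>\<^bsub>G\<^esub> = id
     \<and> (\<forall>g\<in>carrier G. \<forall>h\<in>carrier G. \<rho> (g \<otimes>\<^bsub>G\<^esub> h) = \<rho> g \<circ> \<rho> h)"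

definition invariant_hermitian ::
  "('g, 'b) monoid_scheme \<Rightarrow> ('g \<Rightarrow> 'v::complex_vector \<Rightarrow> 'v) \<Rightarrow> ('v \<Rightarrow> 'v \<Rightarrow> complex) \<Rightarrow> bool" where
  "invariant_hermitian G \<rho> ip \<longleftrightarrow>
     (\<forall>x y z. ip (x + y) z = ip x z + ip y z) \<and> (\<forall>c x y. ip (c *\<^sub>C x) y = c * ip x y)
     \<and> (\<forall>x y. ip y x = cnj (ip x y)) \<and> (\<forall>x. x \<noteq> 0 \<longrightarrow> Re (ip x x) > 0)
     \<and> (\<forall>g\<in>carrier G. \<forall>x y. ip (\<rho> g x) (\<rho> g y) = ip x y)"

definition fixed_space :: "('v \<Rightarrow> 'v) \<Rightarrow> 'v set" where
  "fixed_space T = {v. T v = v}"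

definition orth_compl :: "('v \<Rightarrow> 'v \<Rightarrow> complex) \<Rightarrow> 'v set \<Rightarrow> 'v set" where
  "orth_compl ip U = {v. \<forall>u\<in>U. ip u v = 0}"

text \<open>
  For \<open>V = U \<oplus> W\<close>, the subspace \<open>U\<^sup>*\<close> of \<open>V\<^sup>*\<close> consists of the functionals that vanish on \<open>W\<close>.
\<close>

definition functionals_vanishing_on :: "'v::complex_vector set \<Rightarrow> ('v \<Rightarrow> complex) set" where
  "functionals_vanishing_on W = {\<xi>. Vector_Spaces.linear scaleC (*) \<xi> \<and> (\<forall>v\<in>W. \<xi> v = 0)}"


text \<open>
  The vector space underlying \<open>A = S(V) # G\<close> is the space of finitely supported functions from
  \<open>G\<close> to \<open>S(V)\<close>, with \<open>f\<close> times the group element \<open>g\<close> written \<open>Poly_Mapping.single g f\<close>;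
  the multiplication of \<open>A\<close> does not occur below. A \<open>p\<close>-cochain is a function of lists of \<open>p\<close>
  vectors (extended by 0 to the other lists), whose value at \<open>[y\<^sub>1, \<dots>, y\<^sub>p]\<close> is that of the
  corresponding element of \<open>Hom(\<Lambda>\<^sup>p V, A)\<close> at \<open>y\<^sub>1 \<and> \<dots> \<and> y\<^sub>p\<close>.
\<close>

type_synonym ('g, 'v) cochain = "'v list \<Rightarrow> ('g \<Rightarrow>\<^sub>0 'v sym_alg)"

definition wedge :: "('v \<Rightarrow> complex) list \<Rightarrow> 'v list \<Rightarrow> complex" where
  "wedge \<xi>s ys = (if length ys = length \<xi>s
     then det (mat (length \<xi>s) (length \<xi>s) (\<lambda>(i, j). (\<xi>s ! i) (ys ! j))) else 0)"

definition dform :: "nat \<Rightarrow> (nat \<Rightarrow> 'v::complex_vector) \<Rightarrow> nat list \<Rightarrow> 'v list \<Rightarrow> complex" where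
  "dform n x I = wedge (map (dual n x) I)"

definition tens ::
  "'g \<Rightarrow> 'v::complex_vector sym_alg \<Rightarrow> ('v list \<Rightarrow> complex) \<Rightarrow> ('g, 'v) cochain" where
  "tens g f \<omega> = (\<lambda>ys. Poly_Mapping.single g (\<omega> ys *\<^sub>C f))"

inductive_set sums_of :: "('g, 'v::complex_vector) cochain set \<Rightarrow> ('g, 'v) cochain set" for X where
  zero: "(\<lambda>ys. 0) \<in> sums_of X"
| add: "\<gamma> \<in> X \<Longrightarrow> \<delta> \<in> sums_of X \<Longrightarrow> (\<lambda>ys. \<gamma> ys + \<delta> ys) \<in> sums_of X"

text \<open>
  \<open>C p g\<close> and \<open>H p g\<close>. The sets of generators are closed under scalar multiplication, so that
  finite sums of generators are linear combinations.
\<close>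

definition cochains :: "nat \<Rightarrow> 'g \<Rightarrow> ('g, 'v::complex_vector) cochain set" where
  "cochains p g = sums_of {tens g f (wedge \<xi>s) | f \<xi>s.
     length \<xi>s = p \<and> set \<xi>s \<subseteq> functionals_vanishing_on {}}"

definition codim :: "'v::complex_vector set \<Rightarrow> nat" where
  "codim U = cvec.dim (UNIV :: 'v set) - cvec.dim U"

definition H_cochains ::
  "('v \<Rightarrow> 'v \<Rightarrow> complex) \<Rightarrow> ('g \<Rightarrow> 'v \<Rightarrow> 'v) \<Rightarrow> nat \<Rightarrow> 'g \<Rightarrow> ('g, 'v::complex_vector) cochain set" where
  "H_cochains ip \<rho> p g = (let U = fixed_space (\<rho> g); W = orth_compl ip U in
     sums_of {tens g f (wedge (\<xi>s @ \<eta>s)) | f \<xi>s \<eta>s. f \<in> sym_sub U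
       \<and> length \<xi>s + codim U = p \<and> set \<xi>s \<subseteq> functionals_vanishing_on W
       \<and> length \<eta>s = codim U \<and> set \<eta>s \<subseteq> functionals_vanishing_on U})"


definition increasing :: "nat \<Rightarrow> nat \<Rightarrow> nat list set" where
  "increasing n p = {J. length J = p \<and> sorted_wrt (<) J \<and> set J \<subseteq> {1..n}}"

text \<open>
  The coefficient of \<open>\<alpha>\<close> at \<open>dx\<^sub>J\<close>, for increasing \<open>J\<close>, is the value of \<open>\<alpha>\<close> at \<open>x\<^sub>J\<close>; the sum
  over \<open>J\<close> is thus the linear extension to \<open>C p g\<close> of the formula for the elements
  \<open>tens g f (dform n x J)\<close>. Positions in lists count from 0. An element of
  \<open>Hom(S(V)\<^sup>\<otimes>\<^sup>p, S(V))\<close> is a function of the list of its \<open>p\<close> arguments.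
\<close>

definition Upsilon ::
  "nat \<Rightarrow> ('g \<Rightarrow> 'v \<Rightarrow> 'v) \<Rightarrow> 'g \<Rightarrow> (nat \<Rightarrow> 'v) \<Rightarrow> nat \<Rightarrow> ('g, 'v::complex_vector) cochain
     \<Rightarrow> 'v sym_alg list \<Rightarrow> 'v sym_alg" where
  "Upsilon n \<rho> g x p \<alpha> fs = (let e = (\<lambda>i. eigenvalue (\<rho> g) (x i)) in
     \<Sum>J\<in>increasing n p.
       (\<Prod>k<p. sym_map (slot_prod n x e (J ! k)) (quantum_partial n x (J ! k) (e (J ! k)) (fs ! k)))
       * Poly_Mapping.lookup (\<alpha> (map x J)) g)"

text \<open>
  The circle product of \<open>\<alpha> \<in> C p g\<close> and \<open>\<beta> \<in> C q h\<close>, formed with the eigenbases \<open>w\<close> of \<open>g\<close> and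
  \<open>v\<close> of \<open>h\<close> and the auxiliary basis \<open>u\<close>. The exponent \<open>(q - 1) (k - 1)\<close> is an integer since
  \<open>q = 0\<close> is allowed.
\<close>

definition circ ::
  "nat \<Rightarrow> ('g, 'b) monoid_scheme \<Rightarrow> ('g \<Rightarrow> 'v \<Rightarrow> 'v) \<Rightarrow> 'g \<Rightarrow> 'g
     \<Rightarrow> (nat \<Rightarrow> 'v) \<Rightarrow> (nat \<Rightarrow> 'v) \<Rightarrow> (nat \<Rightarrow> 'v) \<Rightarrow> nat \<Rightarrow> nat
     \<Rightarrow> ('g, 'v::complex_vector) cochain \<Rightarrow> ('g, 'v) cochain \<Rightarrow> ('g, 'v) cochain" where
  "circ n G \<rho> g h w v u p q \<alpha> \<beta> = (\<lambda>ys.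
     \<Sum>I\<in>{I. length I = p + q - 1 \<and> set I \<subseteq> {1..n}}. \<Sum>k = 1..p.
       tens (g \<otimes>\<^bsub>G\<^esub> h)
         (((-1) powi ((int q - 1) * (int k - 1))) *\<^sub>C
           Upsilon n \<rho> g w p \<alpha>
             (map (\<lambda>i. sym_incl (u i)) (take (k - 1) I)
              @ [Upsilon n \<rho> h v q \<beta> (map (\<lambda>i. sym_incl (u i)) (take q (drop (k - 1) I)))]
              @ map (\<lambda>i. sym_incl (\<rho> h (u i))) (drop (k + q - 1) I)))
         (dform n u I) ys)"

text \<open>\<open>det (M\<^bsub>R;I-L\<^esub>)\<close> for a matrix with entries \<open>M i j\<close>, \<open>1 \<le> i, j \<le> n\<close>.\<close>

definition minor_minus ::
  "(nat \<Rightarrow> nat \<Rightarrow> complex) \<Rightarrow> nat list \<Rightarrow> nat list \<Rightarrow> nat list \<Rightarrow> complex" where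
  "minor_minus M R I L = (if set L \<subseteq> set I
     then (let C = filter (\<lambda>i. i \<notin> set L) I
           in det (mat (length R) (length C) (\<lambda>(r, c). M (R ! r) (C ! c))))
     else 0)"

end

theory Submission
  imports Defs "HOL-Computational_Algebra.Polynomial"
begin

text \<open>
  On linear forms the quantum partial derivatives are the dual basis functionals, so each summand of
  \<open>\<alpha> \<circ> \<beta>\<close> is a value of a tensor product of functionals, and summing over all multi-indices \<open>I\<close>
  turns that tensor product into a wedge product, whatever the auxiliary basis: up to sign the \<open>k\<close>th
  summand is \<open>w\<^sup>*\<close> over \<open>j\<^sub>1, \<dots>, j\<^bsub>k-1\<^esub>\<close>, then \<open>v\<^sup>*\<close> over \<open>L\<close>, then \<open>w\<^sup>* \<circ> h\<close> over \<open>j\<^bsub>k+1\<^esub>, \<dots>, j\<^sub>p\<close>.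
  At \<open>v\<^sub>I\<close> the rows of \<open>L\<close> are unit vectors, and Laplace expansion leaves a minor with columns \<open>I - L\<close>.
  The eigenvalues of \<open>h\<close> do not enter it: as \<open>\<beta> \<in> H\<close>, the set \<open>L\<close> contains every index at which \<open>h\<close>
  has an eigenvalue different from 1 (unless \<open>f'\<^sub>h = 0\<close>).
\<close>

section \<open>The universal property of the symmetric algebra\<close>

text \<open>An update at a key outside the support adds a monomial, so induction by updates becomes
  induction along sums, the form suited to additive maps.\<close>

lemma poly_mapping_additive_induct [case_names zero single add]:
  fixes f :: "'a \<Rightarrow>\<^sub>0 'b::comm_monoid_add"
  assumes "P 0" and "\<And>k c. P (Poly_Mapping.single k c)"
    and "\<And>f1 f2. P f1 \<Longrightarrow> P f2 \<Longrightarrow> P (f1 + f2)"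
  shows "P f"
proof (induction f rule: update_induct)
  case const
  then show ?case by (rule assms)
next
  case (update f a b)
  have "Poly_Mapping.update a b f = Poly_Mapping.single a b + f"
    using update by (intro poly_mapping_eqI)
      (auto simp: lookup_update lookup_add lookup_single when_def in_keys_iff)
  then show ?case using update assms by simp
qed

definition eval_monom :: "('v \<Rightarrow> 'b::comm_monoid_mult) \<Rightarrow> ('v \<Rightarrow>\<^sub>0 nat) \<Rightarrow> 'b" where
  "eval_monom t k = (\<Prod>v\<in>Poly_Mapping.keys k. t v ^ Poly_Mapping.lookup k v)"

lemma eval_monom_superset:
  "finite K \<Longrightarrow> Poly_Mapping.keys k \<subseteq> K \<Longrightarrow> eval_monom t k = (\<Prod>v\<in>K. t v ^ Poly_Mapping.lookup k v)"
  unfolding eval_monom_def by (rule prod.mono_neutral_left) (auto simp: in_keys_iff)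

lemma eval_monom_0 [simp]: "eval_monom t 0 = 1"
  by (simp add: eval_monom_def)

lemma eval_monom_single [simp]: "eval_monom t (Poly_Mapping.single v e) = t v ^ e"
  by (simp add: eval_monom_def)

lemma eval_monom_add: "eval_monom t (k + l) = eval_monom t k * eval_monom t l"
proof -
  let ?K = "Poly_Mapping.keys k \<union> Poly_Mapping.keys l"
  have "eval_monom t (k + l) = (\<Prod>v\<in>?K. t v ^ Poly_Mapping.lookup (k + l) v)"
    by (rule eval_monom_superset) (simp, rule keys_add)
  also have "\<dots> = (\<Prod>v\<in>?K. t v ^ Poly_Mapping.lookup k v) * (\<Prod>v\<in>?K. t v ^ Poly_Mapping.lookup l v)"
    by (simp add: lookup_add power_add prod.distrib)
  also have "\<dots> = eval_monom t k * eval_monom t l"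
    by (simp add: eval_monom_superset[of ?K])
  finally show ?thesis .
qed

text \<open>The target is only a ring; its structure of complex algebra is the map
  \<open>\<kappa>\<close>, assumed below to be a ring homomorphism. This lets both
  \<open>S(V)\<close> and \<open>S(V)[X]\<close> serve as targets.\<close>

definition free_eval :: "(complex \<Rightarrow> 'b) \<Rightarrow> ('v \<Rightarrow> 'b) \<Rightarrow> 'v free_alg \<Rightarrow> 'b::comm_ring_1" where
  "free_eval \<kappa> t f = (\<Sum>k\<in>Poly_Mapping.keys f. \<kappa> (Poly_Mapping.lookup f k) * eval_monom t k)"

context
  fixes \<kappa> :: "complex \<Rightarrow> 'b::comm_ring_1" and t :: "'v \<Rightarrow> 'b"
  assumes \<kappa>_add: "\<And>c d. \<kappa> (c + d) = \<kappa> c + \<kappa> d"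
    and \<kappa>_mult: "\<And>c d. \<kappa> (c * d) = \<kappa> c * \<kappa> d"
    and \<kappa>_one: "\<kappa> 1 = 1"
begin

lemma \<kappa>_0: "\<kappa> 0 = 0"
  using \<kappa>_add[of 0 0] by simp

lemma free_eval_superset:
  "finite K \<Longrightarrow> Poly_Mapping.keys f \<subseteq> K \<Longrightarrow>
    free_eval \<kappa> t f = (\<Sum>k\<in>K. \<kappa> (Poly_Mapping.lookup f k) * eval_monom t k)"
  unfolding free_eval_def by (rule sum.mono_neutral_left) (auto simp: in_keys_iff \<kappa>_0)

lemma free_eval_add: "free_eval \<kappa> t (f1 + f2) = free_eval \<kappa> t f1 + free_eval \<kappa> t f2"
proof -
  let ?K = "Poly_Mapping.keys f1 \<union> Poly_Mapping.keys f2"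
  have "free_eval \<kappa> t (f1 + f2) = (\<Sum>k\<in>?K. \<kappa> (Poly_Mapping.lookup (f1 + f2) k) * eval_monom t k)"
    by (rule free_eval_superset) (simp, rule keys_add)
  also have "\<dots> = (\<Sum>k\<in>?K. \<kappa> (Poly_Mapping.lookup f1 k) * eval_monom t k)
      + (\<Sum>k\<in>?K. \<kappa> (Poly_Mapping.lookup f2 k) * eval_monom t k)"
    by (simp add: lookup_add \<kappa>_add algebra_simps sum.distrib)
  also have "\<dots> = free_eval \<kappa> t f1 + free_eval \<kappa> t f2"
    by (simp add: free_eval_superset[of ?K])
  finally show ?thesis .
qed

lemma free_eval_0: "free_eval \<kappa> t 0 = 0"
  by (simp add: free_eval_def)

lemma free_eval_single: "free_eval \<kappa> t (Poly_Mapping.single k c) = \<kappa> c * eval_monom t k"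
  by (simp add: free_eval_def \<kappa>_0)

lemma free_eval_mult: "free_eval \<kappa> t (f1 * f2) = free_eval \<kappa> t f1 * free_eval \<kappa> t f2"
proof (induction f1 rule: poly_mapping_additive_induct)
  case (single k c)
  show ?case
  proof (induction f2 rule: poly_mapping_additive_induct)
    case (single l d)
    show ?case
      by (simp add: mult_single free_eval_single \<kappa>_mult eval_monom_add mult_ac)
  qed (simp_all add: free_eval_0 free_eval_add algebra_simps)
qed (simp_all add: free_eval_0 free_eval_add algebra_simps)

lemma free_eval_diff: "free_eval \<kappa> t (f1 - f2) = free_eval \<kappa> t f1 - free_eval \<kappa> t f2"
  using free_eval_add[of "f1 - f2" f2] by simp

lemma free_eval_var: "free_eval \<kappa> t (free_var v) = t v"
  by (simp add: free_var_def free_eval_single \<kappa>_one)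

lemma free_eval_const: "free_eval \<kappa> t (free_const c) = \<kappa> c"
  by (simp add: free_const_def free_eval_single)

end

text \<open>Evaluation at a linear \<open>t\<close> kills the generators of
  \<open>lin_ideal\<close>, hence the whole ideal, and therefore descends to the quotient.\<close>

lemma sym_alg_lift:
  fixes \<kappa> :: "complex \<Rightarrow> 'b::comm_ring_1" and t :: "'v::complex_vector \<Rightarrow> 'b"
  assumes \<kappa>: "\<And>c d. \<kappa> (c + d) = \<kappa> c + \<kappa> d" "\<And>c d. \<kappa> (c * d) = \<kappa> c * \<kappa> d" "\<kappa> 1 = 1"
    and t: "\<And>x y. t (x + y) = t x + t y" "\<And>c x. t (c *\<^sub>C x) = \<kappa> c * t x"
  obtains \<phi> :: "'v sym_alg \<Rightarrow> 'b"
  where "\<And>f1 f2. \<phi> (f1 + f2) = \<phi> f1 + \<phi> f2" "\<And>f1 f2. \<phi> (f1 * f2) = \<phi> f1 * \<phi> f2" "\<phi> 1 = 1"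
    "\<And>c f. \<phi> (c *\<^sub>C f) = \<kappa> c * \<phi> f" "\<And>x. \<phi> (sym_incl x) = t x"
proof -
  note ev = free_eval_add[OF \<kappa>, of t] free_eval_mult[OF \<kappa>, of t] free_eval_diff[OF \<kappa>, of t]
    free_eval_var[OF \<kappa>, of t] free_eval_const[OF \<kappa>, of t]
  have ideal: "free_eval \<kappa> t f = 0" if "f \<in> lin_ideal" for f
    using that unfolding lin_ideal_def
  proof (induction rule: module.span_induct_alt[OF module_times, consumes 1])
    case 1
    then show ?case by (simp add: free_eval_0[OF \<kappa>])
  next
    case (2 c r y)
    then show ?case by (auto simp: lin_rels_def ev t)
  qed
  define \<phi> where "\<phi> f = free_eval \<kappa> t (rep_sym_alg f)" for f
  \<comment> \<open>The chosen representative does not matter: two representatives of a class differ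
    by an element of the ideal, which \<open>free_eval\<close> kills.\<close>
  have \<phi>_abs: "\<phi> (abs_sym_alg f) = free_eval \<kappa> t f" for f
  proof -
    have "rep_sym_alg (abs_sym_alg f) - f \<in> lin_ideal"
      by (rule rep_abs_rsp_left[OF Quotient3_sym_alg]) (simp add: lin_ideal_0)
    then show ?thesis using ideal ev(3) unfolding \<phi>_def by (metis eq_iff_diff_eq_0)
  qed
  have abs: "\<exists>f'. f = abs_sym_alg f'" for f :: "'v sym_alg"
    using Quotient3_abs_rep[OF Quotient3_sym_alg] by metis
  show ?thesis
  proof (rule that)
    show "\<phi> (f1 + f2) = \<phi> f1 + \<phi> f2" for f1 f2
      using abs[of f1] abs[of f2] by (auto simp: \<phi>_abs plus_sym_alg.abs_eq ev)
    show "\<phi> (f1 * f2) = \<phi> f1 * \<phi> f2" for f1 f2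
      using abs[of f1] abs[of f2] by (auto simp: \<phi>_abs times_sym_alg.abs_eq ev)
    show "\<phi> 1 = 1"
      by (simp add: one_sym_alg_def \<phi>_abs single_one[symmetric] free_eval_single[OF \<kappa>] \<kappa>(3)
        del: single_one)
    show "\<phi> (c *\<^sub>C f) = \<kappa> c * \<phi> f" for c f
      using abs[of f] by (auto simp: \<phi>_abs scaleC_sym_alg.abs_eq ev)
    show "\<phi> (sym_incl x) = t x" for x
      by (simp add: sym_incl_def \<phi>_abs ev)
  qed
qed

lemma sym_incl_add: "sym_incl (x + y) = sym_incl x + sym_incl y"
proof transfer
  fix x y :: 'a
  have "free_var (x + y) - free_var x - free_var y \<in> (lin_ideal :: 'a free_alg set)"
    unfolding lin_ideal_def
    by (rule Modules.module.span_base[OF module_times]) (auto simp: lin_rels_def)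
  then show "free_var (x + y) - (free_var x + free_var y) \<in> lin_ideal"
    by (simp add: algebra_simps)
qed

lemma sym_incl_scale: "sym_incl (c *\<^sub>C x) = c *\<^sub>C sym_incl x"
proof transfer
  fix x :: 'a and c
  show "free_var (c *\<^sub>C x) - free_const c * free_var x \<in> lin_ideal"
    unfolding lin_ideal_def
    by (rule Modules.module.span_base[OF module_times]) (auto simp: lin_rels_def)
qed

lemma clinear_sym_incl: "clinear sym_incl"
  by unfold_locales (simp_all add: sym_incl_add sym_incl_scale)

lemma scaleC_mult_left [simp]: "(c *\<^sub>C f1) * f2 = c *\<^sub>C (f1 * f2 :: 'v::complex_vector sym_alg)"
  by transfer (simp add: mult.assoc lin_ideal_0)

lemma scaleC_mult_right [simp]: "f1 * (c *\<^sub>C f2) = c *\<^sub>C (f1 * f2 :: 'v::complex_vector sym_alg)"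
  by (metis mult.commute scaleC_mult_left)

text \<open>Polynomials are sums of scalar multiples of monomials, and monomials are products of
  vectors, so these closure properties reach every element. Claims about algebra maps thereby reduce
  to claims about vectors.\<close>

lemma sym_alg_induct [case_names one incl scale add mult]:
  fixes f :: "'v::complex_vector sym_alg"
  assumes one: "P 1" and incl: "\<And>v. P (sym_incl v)" and scale: "\<And>c f. P f \<Longrightarrow> P (c *\<^sub>C f)"
    and add: "\<And>f1 f2. P f1 \<Longrightarrow> P f2 \<Longrightarrow> P (f1 + f2)"
    and mult: "\<And>f1 f2. P f1 \<Longrightarrow> P f2 \<Longrightarrow> P (f1 * f2)"
  shows "P f"
proof -
  \<comment> \<open>The multiple of \<open>1\<close> by the scalar 0 takes the place of a separate
    zero case.\<close>
  have zero: "P 0"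
    using scale[OF one, of 0] by simp
  have monom: "P (abs_sym_alg (Poly_Mapping.single k 1))" for k
  proof (induction k rule: poly_mapping_additive_induct)
    case zero
    then show ?case using one by (simp add: one_sym_alg_def)
  next
    case (single v e)
    show ?case
    proof (induction e)
      case 0
      then show ?case using one by (simp add: one_sym_alg_def)
    next
      case (Suc e)
      have "abs_sym_alg (Poly_Mapping.single (Poly_Mapping.single v (Suc e)) 1) =
          sym_incl v * abs_sym_alg (Poly_Mapping.single (Poly_Mapping.single v e) 1)"
        by (simp add: sym_incl_def free_var_def times_sym_alg.abs_eq mult_single single_add[symmetric])
      then show ?case using mult[OF incl Suc] by simp
    qed
  next
    case (add k l)
    then show ?case
      using mult by (metis mult_single mult_1 times_sym_alg.abs_eq)
  qed
  have "P (abs_sym_alg f)" for f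
  proof (induction f rule: poly_mapping_additive_induct)
    case zero
    then show ?case using \<open>P 0\<close> by (simp add: zero_sym_alg_def)
  next
    case (single k c)
    have "abs_sym_alg (Poly_Mapping.single k c) = c *\<^sub>C abs_sym_alg (Poly_Mapping.single k 1)"
      by (simp add: scaleC_sym_alg.abs_eq free_const_def mult_single)
    then show ?case using scale[OF monom] by simp
  next
    case (add f1 f2)
    then show ?case using assms(4) by (simp add: plus_sym_alg.abs_eq[symmetric])
  qed
  then show ?thesis
    using Quotient3_abs_rep[OF Quotient3_sym_alg] by metis
qed

section \<open>Linear maps, coordinates and induced algebra maps\<close>

lemma
  assumes "clinear T"
  shows clinear_add: "T (x + y) = T x + T y"
    and clinear_scale: "T (c *\<^sub>C x) = c *\<^sub>C T x"
    and clinear_zero: "T 0 = 0"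
    and clinear_sum: "T (sum F A) = (\<Sum>a\<in>A. T (F a))"
proof -
  interpret Vector_Spaces.linear scaleC scaleC T by fact
  show "T (x + y) = T x + T y" "T (c *\<^sub>C x) = c *\<^sub>C T x" "T 0 = 0" "T (sum F A) = (\<Sum>a\<in>A. T (F a))"
    by (rule add scale zero sum)+
qed

lemma sym_incl_0 [simp]: "sym_incl 0 = 0"
  by (rule clinear_zero[OF clinear_sym_incl])

lemma dual_add: "is_basis n x \<Longrightarrow> dual n x i (y + z) = dual n x i y + dual n x i z"
  by (simp add: dual_def is_basis_def cvec.representation_add)

lemma dual_scale: "is_basis n x \<Longrightarrow> dual n x i (c *\<^sub>C y) = c * dual n x i y"
  by (simp add: dual_def is_basis_def cvec.representation_scale)

lemma linear_dual:
  assumes "is_basis n x"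
  shows "Vector_Spaces.linear scaleC (*) (dual n x i)"
proof unfold_locales
  show "dual n x i (y + z) = dual n x i y + dual n x i z" "dual n x i (c *\<^sub>C y) = c * dual n x i y"
    for y z c by (rule dual_add[OF assms] dual_scale[OF assms])+
qed (simp_all add: distrib_left distrib_right)

lemma dual_basis:
  assumes "is_basis n x" "i \<in> {1..n}" "j \<in> {1..n}"
  shows "dual n x i (x j) = (if j = i then 1 else 0)"
proof -
  have "dual n x i (x j) = (if x j = x i then 1 else 0)"
    unfolding dual_def using assms by (subst cvec.representation_basis) (simp_all add: is_basis_def)
  then show ?thesis using assms by (auto simp: is_basis_def dest: inj_onD)
qed

lemma dual_expansion:
  assumes "is_basis n x"
  shows "(\<Sum>i = 1..n. dual n x i y *\<^sub>C x i) = y"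
proof -
  have "(\<Sum>i = 1..n. dual n x i y *\<^sub>C x i) =
      (\<Sum>b\<in>x ` {1..n}. cvec.representation (x ` {1..n}) y b *\<^sub>C b)"
    using assms by (simp add: is_basis_def dual_def sum.reindex)
  also have "\<dots> = y"
    using assms by (intro cvec.sum_representation_eq) (auto simp: is_basis_def)
  finally show ?thesis .
qed

lemma basis_nonzero: "is_basis n x \<Longrightarrow> i \<in> {1..n} \<Longrightarrow> x i \<noteq> 0"
  by (metis cvec.dependent_zero image_eqI is_basis_def)

text \<open>\<open>sym_map\<close> is a definite description: existence comes from the universal
  property with scalars embedded as \<open>c *\<^sub>C 1\<close>, uniqueness from agreement on
  vectors.\<close>

lemma
  assumes "clinear T"
  shows sym_map_linear: "clinear (sym_map T)"
    and sym_map_one: "sym_map T 1 = 1"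
    and sym_map_mult: "sym_map T (f1 * f2) = sym_map T f1 * sym_map T f2"
    and sym_map_incl: "sym_map T (sym_incl v) = sym_incl (T v)"
proof -
  interpret T: Vector_Spaces.linear scaleC scaleC T by fact
  let ?P = "\<lambda>\<phi>. clinear \<phi> \<and> \<phi> 1 = 1 \<and> (\<forall>f1 f2. \<phi> (f1 * f2) = \<phi> f1 * \<phi> f2)
     \<and> (\<forall>v. \<phi> (sym_incl v) = sym_incl (T v))"
  obtain \<phi> :: "'a sym_alg \<Rightarrow> 'a sym_alg" where \<phi>:
    "\<And>f1 f2. \<phi> (f1 + f2) = \<phi> f1 + \<phi> f2" "\<And>f1 f2. \<phi> (f1 * f2) = \<phi> f1 * \<phi> f2" "\<phi> 1 = 1"
    "\<And>c f. \<phi> (c *\<^sub>C f) = (c *\<^sub>C 1) * \<phi> f" "\<And>x. \<phi> (sym_incl x) = sym_incl (T x)"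
    by (rule sym_alg_lift[where \<kappa> = "\<lambda>c. c *\<^sub>C (1 :: 'a sym_alg)" and t = "\<lambda>x. sym_incl (T x)"])
      (auto simp: scaleC_add_left T.add T.scale
        sym_incl_add sym_incl_scale)
  have "clinear \<phi>"
    by unfold_locales (simp_all add: \<phi>)
  then have ex: "?P \<phi>" using \<phi> by blast
  have unique: "\<psi> = \<phi>" if "?P \<psi>" for \<psi>
  proof
    interpret \<psi>: Vector_Spaces.linear scaleC scaleC \<psi> using that by blast
    show "\<psi> f = \<phi> f" for f
      by (induction f rule: sym_alg_induct)
        (use that in \<open>simp_all add: \<phi> \<psi>.add \<psi>.scale\<close>)
  qed
  have "?P (sym_map T)"
    unfolding sym_map_def using ex unique by (rule theI)
  then show "clinear (sym_map T)" "sym_map T 1 = 1" "sym_map T (f1 * f2) = sym_map T f1 * sym_map T f2"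
    "sym_map T (sym_incl v) = sym_incl (T v)" by blast+
qed

lemma sym_map_scale: "clinear T \<Longrightarrow> sym_map T (c *\<^sub>C f) = c *\<^sub>C sym_map T f"
  by (rule clinear_scale[OF sym_map_linear])

lemma sym_map_add: "clinear T \<Longrightarrow> sym_map T (f1 + f2) = sym_map T f1 + sym_map T f2"
  by (rule clinear_add[OF sym_map_linear])

lemma sym_map_const: "clinear T \<Longrightarrow> sym_map T (c *\<^sub>C 1) = c *\<^sub>C 1"
  by (simp add: sym_map_scale sym_map_one)

section \<open>Quantum partial derivatives\<close>

lemma linear_diag_slot:
  assumes "is_basis n x"
  shows "clinear (diag_slot n x i e)"
proof unfold_locales
  show "diag_slot n x i e (y + z) = diag_slot n x i e y + diag_slot n x i e z" for y z
    by (simp add: diag_slot_def dual_add[OF assms] scaleC_add_left distrib_left sum.distrib)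
  show "diag_slot n x i e (c *\<^sub>C y) = c *\<^sub>C diag_slot n x i e y" for c y
    unfolding diag_slot_def dual_scale[OF assms] cvec.scale_sum_right
    by (simp only: scaleC_scaleC mult.left_commute[of _ c])
qed

text \<open>The diagonal map is a rank-one perturbation of the identity; this form isolates the
  multiple of \<open>x i\<close> by which a vector and its image differ.\<close>

lemma diag_slot_eq:
  assumes "is_basis n x" "i \<in> {1..n}"
  shows "diag_slot n x i e y = y + ((e - 1) * dual n x i y) *\<^sub>C x i"
proof -
  have "diag_slot n x i e y =
      (\<Sum>j = 1..n. dual n x j y *\<^sub>C x j + (if j = i then ((e - 1) * dual n x i y) *\<^sub>C x i else 0))"
    unfolding diag_slot_def
    by (rule sum.cong) (auto simp: scaleC_add_left[symmetric] left_diff_distrib)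
  then show ?thesis
    using assms dual_expansion[OF assms(1)] by (simp add: sum.distrib)
qed

lemma linear_slot_prod:
  assumes "is_basis n x"
  shows "clinear (slot_prod n x e j)"
proof -
  \<comment> \<open>An arbitrary list of slots replaces \<open>[1..<j]\<close>, so that the
    induction can peel off the outermost factor.\<close>
  have "clinear (foldr (\<circ>) (map (\<lambda>i. diag_slot n x i (e i)) is) id)" for "is"
  proof (induction "is")
    case Nil
    show ?case by unfold_locales simp_all
  next
    case (Cons i "is")
    have "foldr (\<circ>) (map (\<lambda>i. diag_slot n x i (e i)) (i # is)) id =
        diag_slot n x i (e i) \<circ> foldr (\<circ>) (map (\<lambda>i. diag_slot n x i (e i)) is) id"
      by simp
    then show ?case
      using Vector_Spaces.linear_compose[OF Cons linear_diag_slot[OF assms]] by metis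
  qed
  then show ?thesis by (simp add: slot_prod_def)
qed

text \<open>
  The substitution \<open>y \<mapsto> y - \<xi>(y) x + \<xi>(y) X\<close> into \<open>S(V)[X]\<close> is a section of \<open>X \<mapsto> x\<close> and sends
  \<open>x\<close> to the nonzerodivisor \<open>X\<close>.
\<close>

lemma sym_incl_nonzerodivisor:
  fixes x :: "'v::complex_vector"
  assumes \<xi>: "Vector_Spaces.linear scaleC (*) \<xi>" and "\<xi> x = 1" and r: "r * sym_incl x = 0"
  shows "r = 0"
proof -
  interpret \<xi>: Vector_Spaces.linear scaleC "(*)" \<xi> by fact
  obtain \<phi> :: "'v sym_alg \<Rightarrow> 'v sym_alg poly" where \<phi>:
    "\<And>f1 f2. \<phi> (f1 + f2) = \<phi> f1 + \<phi> f2" "\<And>f1 f2. \<phi> (f1 * f2) = \<phi> f1 * \<phi> f2" "\<phi> 1 = 1"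
    "\<And>c f. \<phi> (c *\<^sub>C f) = [:c *\<^sub>C 1:] * \<phi> f"
    "\<And>y. \<phi> (sym_incl y) = [:sym_incl (y - \<xi> y *\<^sub>C x), \<xi> y *\<^sub>C 1:]"
    by (rule sym_alg_lift[where \<kappa> = "\<lambda>c. [:c *\<^sub>C (1 :: 'v sym_alg):]"
          and t = "\<lambda>y. [:sym_incl (y - \<xi> y *\<^sub>C x), \<xi> y *\<^sub>C 1:]"])
      (auto simp: scaleC_add_left \<xi>.add \<xi>.scale
        sym_incl_add[symmetric] sym_incl_scale[symmetric] cvec.scale_right_diff_distrib mult_ac
        algebra_simps one_pCons)
  have retract: "poly (\<phi> f) (sym_incl x) = f" for f
    by (induction f rule: sym_alg_induct)
      (simp_all add: \<phi> flip: sym_incl_scale sym_incl_add)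
  have "0 = \<phi> (r * sym_incl x)"
    using \<phi>(1)[of 0 0] r by simp
  also have "\<dots> = pCons 0 (\<phi> r)"
    using \<open>\<xi> x = 1\<close> by (simp add: \<phi>)
  finally have "\<phi> r = 0" by simp
  then show ?thesis using retract[of r] by simp
qed

text \<open>Existence is a Taylor expansion to first order: the coefficient of \<open>X\<close> in
  the algebra map \<open>y \<mapsto> y + dual n x i y X\<close> into \<open>S(V)[X]\<close> is a
  derivation. Uniqueness holds because linearity, the Leibniz rule and the values on a basis
  determine everything.\<close>

lemma
  fixes x :: "nat \<Rightarrow> 'v::complex_vector"
  assumes basis: "is_basis n x" and i: "i \<in> {1..n}"
  shows partial_linear: "clinear (partial n x i)"
    and partial_basis: "j \<in> {1..n} \<Longrightarrow> partial n x i (sym_incl (x j)) = (if j = i then 1 else 0)"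
proof -
  let ?P = "\<lambda>D. clinear D \<and> (\<forall>f1 f2. D (f1 * f2) = D f1 * f2 + f1 * D f2)
     \<and> (\<forall>j\<in>{1..n}. D (sym_incl (x j)) = (if j = i then 1 else 0))"
  obtain \<phi> :: "'v sym_alg \<Rightarrow> 'v sym_alg poly" where \<phi>:
    "\<And>f1 f2. \<phi> (f1 + f2) = \<phi> f1 + \<phi> f2" "\<And>f1 f2. \<phi> (f1 * f2) = \<phi> f1 * \<phi> f2" "\<phi> 1 = 1"
    "\<And>c f. \<phi> (c *\<^sub>C f) = [:c *\<^sub>C 1:] * \<phi> f"
    "\<And>y. \<phi> (sym_incl y) = [:sym_incl y, dual n x i y *\<^sub>C 1:]"
    by (rule sym_alg_lift[where \<kappa> = "\<lambda>c. [:c *\<^sub>C (1 :: 'v sym_alg):]"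
          and t = "\<lambda>y. [:sym_incl y, dual n x i y *\<^sub>C 1:]"])
      (auto simp: scaleC_add_left dual_add[OF basis]
        dual_scale[OF basis] sym_incl_add sym_incl_scale one_pCons)
  define D where "D f = coeff (\<phi> f) 1" for f
  \<comment> \<open>The constant coefficient returns \<open>f\<close> itself, so the product formula
    for the coefficient of \<open>X\<close> is the Leibniz rule.\<close>
  have coeff0: "coeff (\<phi> f) 0 = f" for f
    by (induction f rule: sym_alg_induct)
      (simp_all add: \<phi> coeff_mult)
  have "clinear D"
    by unfold_locales (simp_all add: D_def \<phi>)
  moreover have "D (f1 * f2) = D f1 * f2 + f1 * D f2" for f1 f2
    by (simp add: D_def \<phi> coeff_mult coeff0)
  moreover have "\<forall>j\<in>{1..n}. D (sym_incl (x j)) = (if j = i then 1 else 0)"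
    using i by (auto simp: D_def \<phi> dual_basis[OF basis] scaleC_one)
  ultimately have ex: "?P D" by blast
  have unique: "E = D" if E: "?P E" for E
  proof -
    interpret E: Vector_Spaces.linear scaleC scaleC E using E by blast
    interpret D: Vector_Spaces.linear scaleC scaleC D by fact
    \<comment> \<open>The Leibniz rule at \<open>1 * 1\<close> forces the value 0 at
      \<open>1\<close>.\<close>
    have one: "E' 1 = 0" if "\<And>f1 f2. E' (f1 * f2) = E' f1 * f2 + f1 * E' f2" for E' :: "'v sym_alg \<Rightarrow> 'v sym_alg"
      using that[of 1 1] by simp
    have incl: "E (sym_incl y) = D (sym_incl y)" for y
    proof -
      have "sym_incl y = (\<Sum>j = 1..n. dual n x j y *\<^sub>C sym_incl (x j))"
        by (subst (1) dual_expansion[OF basis, symmetric])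
          (simp add: clinear_sum[OF clinear_sym_incl]
            sym_incl_scale)
      then show ?thesis
        using E ex by (simp add: E.sum D.sum E.scale D.scale)
    qed
    have "E f = D f" for f
      by (induction f rule: sym_alg_induct)
        (use E ex one[of E] one[of D] incl in \<open>simp_all add: E.add D.add E.scale D.scale\<close>)
    then show ?thesis ..
  qed
  have "?P (partial n x i)"
    unfolding partial_def using ex unique by (rule theI)
  then show "clinear (partial n x i)"
    "j \<in> {1..n} \<Longrightarrow> partial n x i (sym_incl (x j)) = (if j = i then 1 else 0)" by auto
qed

lemma partial_sym_incl:
  assumes basis: "is_basis n x" and i: "i \<in> {1..n}"
  shows "partial n x i (sym_incl y) = dual n x i y *\<^sub>C 1"
proof -
  interpret D: Vector_Spaces.linear scaleC scaleC "partial n x i"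
    using assms by (rule partial_linear)
  have "sym_incl y = (\<Sum>j = 1..n. dual n x j y *\<^sub>C sym_incl (x j))"
    by (subst (1) dual_expansion[OF basis, symmetric])
      (simp add: clinear_sum[OF clinear_sym_incl]
        sym_incl_scale)
  then have "partial n x i (sym_incl y) = (\<Sum>j = 1..n. if j = i then dual n x i y *\<^sub>C 1 else 0)"
    by (simp add: D.sum D.scale partial_basis[OF assms] if_distrib cong: if_cong)
  then show ?thesis using i by simp
qed

section \<open>Existence and uniqueness of the quantum quotients\<close>

lemma diff_sym_map_diag_slot_incl:
  assumes "is_basis n x" "i \<in> {1..n}"
  shows "sym_incl y - sym_map (diag_slot n x i e) (sym_incl y) = ((1 - e) * dual n x i y) *\<^sub>C sym_incl (x i)"
proof -
  have "((1 - e) * dual n x i y) *\<^sub>C sym_incl (x i) = - (((e - 1) * dual n x i y) *\<^sub>C sym_incl (x i))"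
    by (metis cvec.scale_minus_left minus_diff_eq mult_minus_left)
  then show ?thesis
    by (simp add: sym_map_incl[OF linear_diag_slot[OF assms(1)]] diag_slot_eq[OF assms]
        sym_incl_add sym_incl_scale)
qed

text \<open>This gives existence of the quotient in \<open>quantum_partial\<close>. Vectors are
  clear from their coordinates, and products follow from the twisted Leibniz identity
  \<open>f1 f2 - s(f1 f2) = (f1 - s f1) f2 + s f1 (f2 - s f2)\<close>.\<close>

lemma sym_map_diag_slot_divisible:
  fixes x :: "nat \<Rightarrow> 'v::complex_vector"
  assumes "is_basis n x" "i \<in> {1..n}"
  shows "\<exists>r. f - sym_map (diag_slot n x i e) f = r * sym_incl (x i)"
proof (induction f rule: sym_alg_induct)
  case one
  then show ?case
    using sym_map_one[OF linear_diag_slot[OF assms(1)]] by (metis diff_self mult_zero_left)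
next
  case (incl y)
  have "sym_incl y - sym_map (diag_slot n x i e) (sym_incl y)
      = ((1 - e) * dual n x i y) *\<^sub>C 1 * sym_incl (x i)"
    by (simp add: diff_sym_map_diag_slot_incl[OF assms])
  then show ?case ..
next
  case (scale c f)
  then obtain r where "f - sym_map (diag_slot n x i e) f = r * sym_incl (x i)" ..
  then have "c *\<^sub>C f - sym_map (diag_slot n x i e) (c *\<^sub>C f) = (c *\<^sub>C r) * sym_incl (x i)"
    by (simp add: sym_map_scale[OF linear_diag_slot[OF assms(1)]]
        cvec.scale_right_diff_distrib[symmetric])
  then show ?case ..
next
  case (add f1 f2)
  then obtain r1 r2 where "f1 - sym_map (diag_slot n x i e) f1 = r1 * sym_incl (x i)"
    "f2 - sym_map (diag_slot n x i e) f2 = r2 * sym_incl (x i)" by blast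
  then have "f1 + f2 - sym_map (diag_slot n x i e) (f1 + f2) = (r1 + r2) * sym_incl (x i)"
    by (simp add: sym_map_add[OF linear_diag_slot[OF assms(1)]] algebra_simps)
  then show ?case ..
next
  case (mult f1 f2)
  let ?s = "sym_map (diag_slot n x i e)"
  from mult obtain r1 r2 where "f1 - ?s f1 = r1 * sym_incl (x i)"
    "f2 - ?s f2 = r2 * sym_incl (x i)" by blast
  moreover have "f1 * f2 - ?s (f1 * f2) = (f1 - ?s f1) * f2 + ?s f1 * (f2 - ?s f2)"
    by (simp add: sym_map_mult[OF linear_diag_slot[OF assms(1)]] algebra_simps)
  ultimately have "f1 * f2 - ?s (f1 * f2) = (r1 * f2 + ?s f1 * r2) * sym_incl (x i)"
    by (simp only: distrib_left distrib_right mult_ac)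
  then show ?case ..
qed

text \<open>The denominator is the unit \<open>1 - e\<close> times the nonzerodivisor
  \<open>sym_incl (x i)\<close>, so any quotient that can be exhibited is the one described.\<close>

lemma quantum_partial_eqI:
  fixes x :: "nat \<Rightarrow> 'v::complex_vector"
  assumes basis: "is_basis n x" and i: "i \<in> {1..n}" and "e \<noteq> 1"
    and r: "f - sym_map (diag_slot n x i e) f = (1 - e) *\<^sub>C r * sym_incl (x i)"
  shows "quantum_partial n x i e f = r"
proof -
  have denom: "sym_incl (x i) - sym_map (diag_slot n x i e) (sym_incl (x i)) = (1 - e) *\<^sub>C sym_incl (x i)"
    using dual_basis[OF basis i i] by (simp add: diff_sym_map_diag_slot_incl[OF assms(1,2)])
  have "(THE r. r * (sym_incl (x i) - sym_map (diag_slot n x i e) (sym_incl (x i)))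
      = f - sym_map (diag_slot n x i e) f) = r"
  proof (rule the_equality, unfold denom r)
    show "r * (1 - e) *\<^sub>C sym_incl (x i) = (1 - e) *\<^sub>C r * sym_incl (x i)"
      by simp
    fix r'
    assume "r' * (1 - e) *\<^sub>C sym_incl (x i) = (1 - e) *\<^sub>C r * sym_incl (x i)"
    then have "(1 - e) *\<^sub>C ((r' - r) * sym_incl (x i)) = 0"
      by (simp add: left_diff_distrib cvec.scale_right_diff_distrib)
    then have "(r' - r) * sym_incl (x i) = 0"
      using \<open>e \<noteq> 1\<close> by simp
    moreover have "dual n x i (x i) = 1"
      using dual_basis[OF basis i i] by simp
    ultimately have "r' - r = 0"
      using sym_incl_nonzerodivisor[OF linear_dual[OF basis]] by blast
    then show "r' = r" by simp
  qed
  then show ?thesis using \<open>e \<noteq> 1\<close> by (simp add: quantum_partial_def)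
qed

text \<open>Numerator and denominator both carry the factor \<open>1 - e\<close>, so on vectors the
  result is the same for every \<open>e\<close>, the ordinary derivative included.\<close>

lemma quantum_partial_sym_incl:
  fixes x :: "nat \<Rightarrow> 'v::complex_vector"
  assumes basis: "is_basis n x" and i: "i \<in> {1..n}"
  shows "quantum_partial n x i e (sym_incl y) = dual n x i y *\<^sub>C 1"
proof (cases "e = 1")
  case True
  then show ?thesis using partial_sym_incl[OF assms] by (simp add: quantum_partial_def)
next
  case False
  then show ?thesis
    by (intro quantum_partial_eqI assms)
      (simp_all add: diff_sym_map_diag_slot_incl[OF assms])
qed

text \<open>A definite description can be scaled only once a quotient is known to exist, which is
  where divisibility for arbitrary \<open>f\<close> enters.\<close>

lemma quantum_partial_scale:
  fixes x :: "nat \<Rightarrow> 'v::complex_vector"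
  assumes basis: "is_basis n x" and i: "i \<in> {1..n}"
  shows "quantum_partial n x i e (c *\<^sub>C f) = c *\<^sub>C quantum_partial n x i e f"
proof (cases "e = 1")
  case True
  then show ?thesis
    using clinear_scale[OF partial_linear[OF assms]] by (simp add: quantum_partial_def)
next
  case False
  obtain r where r: "f - sym_map (diag_slot n x i e) f = r * sym_incl (x i)"
    using sym_map_diag_slot_divisible[OF assms] by blast
  \<comment> \<open>Dividing by \<open>1 - e\<close> brings the quotient into the form that
    \<open>quantum_partial_eqI\<close> expects.\<close>
  define r' where "r' = (1 / (1 - e)) *\<^sub>C r"
  have r': "f - sym_map (diag_slot n x i e) f = (1 - e) *\<^sub>C r' * sym_incl (x i)"
    using False by (simp add: r'_def r)
  have "c *\<^sub>C f - sym_map (diag_slot n x i e) (c *\<^sub>C f) = (1 - e) *\<^sub>C (c *\<^sub>C r') * sym_incl (x i)"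
    using r' by (simp add: sym_map_scale[OF linear_diag_slot[OF basis]]
      cvec.scale_right_diff_distrib[symmetric] mult.commute[of c])
  then show ?thesis
    using r' False by (simp add: quantum_partial_eqI[OF assms])
qed

text \<open>One factor of \<open>Upsilon\<close>. The eigenvalues enter as a function
  \<open>e\<close>, so that given eigenvalues can replace those picked out by
  \<open>eigenvalue\<close>.\<close>

definition slot_partial ::
  "nat \<Rightarrow> (nat \<Rightarrow> 'v::complex_vector) \<Rightarrow> (nat \<Rightarrow> complex) \<Rightarrow> nat \<Rightarrow> 'v sym_alg \<Rightarrow> 'v sym_alg" where
  "slot_partial n x e j f = sym_map (slot_prod n x e j) (quantum_partial n x j (e j) f)"

text \<open>The quantum derivative of a vector is a scalar, and algebra maps fix scalars, so the
  twist by \<open>slot_prod\<close> disappears.\<close>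

lemma slot_partial_sym_incl:
  "is_basis n x \<Longrightarrow> j \<in> {1..n} \<Longrightarrow> slot_partial n x e j (sym_incl y) = dual n x j y *\<^sub>C 1"
  by (simp add: slot_partial_def quantum_partial_sym_incl sym_map_const linear_slot_prod)

lemma slot_partial_scale:
  "is_basis n x \<Longrightarrow> j \<in> {1..n} \<Longrightarrow> slot_partial n x e j (c *\<^sub>C f) = c *\<^sub>C slot_partial n x e j f"
  by (simp add: slot_partial_def quantum_partial_scale sym_map_scale linear_slot_prod)

section \<open>Wedge products of functionals\<close>

text \<open>Laplace expansion along row \<open>length A\<close>;
  \<open>take c ys @ drop (Suc c) ys\<close> deletes column \<open>c\<close>.\<close>

lemma wedge_row_expansion:
  "wedge (A @ \<xi> # B) ys =
    (\<Sum>c<length ys. \<xi> (ys ! c) * ((-1) ^ (length A + c) * wedge (A @ B) (take c ys @ drop (Suc c) ys)))"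
proof (cases "length ys = Suc (length A + length B)")
  case True
  let ?m = "length ys"
  let ?M = "mat ?m ?m (\<lambda>(i, j). ((A @ \<xi> # B) ! i) (ys ! j))"
  have "wedge (A @ \<xi> # B) ys = det ?M"
    using True by (simp add: wedge_def)
  also have "\<dots> = (\<Sum>c<?m. ?M $$ (length A, c) * cofactor ?M (length A) c)"
    using True by (intro laplace_expansion_row) auto
  also have "\<dots> = (\<Sum>c<?m. \<xi> (ys ! c) * ((-1) ^ (length A + c) * wedge (A @ B) (take c ys @ drop (Suc c) ys)))"
  proof (rule sum.cong)
    fix c assume "c \<in> {..<?m}"
    then have c: "c < ?m" by simp
    have "mat_delete ?M (length A) c =
        mat (length (A @ B)) (length (A @ B)) (\<lambda>(i, j). ((A @ B) ! i) ((take c ys @ drop (Suc c) ys) ! j))"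
      using True c by (intro eq_matI) (auto simp: mat_delete_def nth_append)
    then have "cofactor ?M (length A) c = (-1) ^ (length A + c) * wedge (A @ B) (take c ys @ drop (Suc c) ys)"
      using True c by (simp add: cofactor_def wedge_def)
    then show "?M $$ (length A, c) * cofactor ?M (length A) c =
        \<xi> (ys ! c) * ((-1) ^ (length A + c) * wedge (A @ B) (take c ys @ drop (Suc c) ys))"
      using True c by simp
  qed simp
  finally show ?thesis .
next
  case False
  \<comment> \<open>For mismatched lengths the default value 0 of \<open>wedge\<close> makes both
    sides vanish.\<close>
  then have "wedge (A @ B) (take c ys @ drop (Suc c) ys) = 0" if "c < length ys" for c
    using that by (simp add: wedge_def)
  then show ?thesis using False by (simp add: wedge_def)
qed

text \<open>The cofactors in the row expansion do not involve the expanded row, whence linearity in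
  it.\<close>

lemma wedge_row_sum:
  assumes "\<And>y. \<xi> y = (\<Sum>i\<in>K. k i * \<eta> i y)"
  shows "wedge (A @ \<xi> # B) ys = (\<Sum>i\<in>K. k i * wedge (A @ \<eta> i # B) ys)"
proof -
  have "wedge (A @ \<xi> # B) ys = (\<Sum>c<length ys. \<Sum>i\<in>K. k i * (\<eta> i (ys ! c)
      * ((-1) ^ (length A + c) * wedge (A @ B) (take c ys @ drop (Suc c) ys))))"
    by (simp add: wedge_row_expansion assms sum_distrib_right mult.assoc)
  also have "\<dots> = (\<Sum>i\<in>K. k i * wedge (A @ \<eta> i # B) ys)"
    by (subst sum.swap) (simp add: wedge_row_expansion sum_distrib_left)
  finally show ?thesis .
qed

lemma wedge_row_zero:
  assumes "\<xi> \<in> set \<xi>s" "\<And>y. y \<in> set ys \<Longrightarrow> \<xi> y = 0"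
  shows "wedge \<xi>s ys = 0"
proof -
  obtain A B where "\<xi>s = A @ \<xi> # B"
    using split_list[OF assms(1)] by blast
  then show ?thesis
    using assms(2) by (simp add: wedge_row_expansion)
qed

lemma wedge_row_unit:
  assumes "c < length ys" "\<And>d. d < length ys \<Longrightarrow> \<xi> (ys ! d) = (if d = c then 1 else 0)"
  shows "wedge (A @ \<xi> # B) ys = (-1) ^ (length A + c) * wedge (A @ B) (take c ys @ drop (Suc c) ys)"
proof -
  have "wedge (A @ \<xi> # B) ys = (\<Sum>d<length ys. if d = c
      then (-1) ^ (length A + c) * wedge (A @ B) (take c ys @ drop (Suc c) ys) else 0)"
    unfolding wedge_row_expansion by (rule sum.cong) (auto simp: assms(2))
  then show ?thesis using assms(1) by simp
qed

lemma wedge_cong: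
  assumes "length \<xi>s = length \<eta>s"
    and "\<And>i y. i < length \<xi>s \<Longrightarrow> y \<in> set ys \<Longrightarrow> (\<xi>s ! i) y = (\<eta>s ! i) y"
  shows "wedge \<xi>s ys = wedge \<eta>s ys"
  unfolding wedge_def using assms by (auto intro!: arg_cong[of _ _ det] eq_matI)

text \<open>Leibniz formula and pigeonhole: a nonzero term would map the rows of
  \<open>\<eta>s\<close> injectively into the columns counted here, of which there are too
  few.\<close>

lemma wedge_zero_block:
  assumes "card {c. c < length ys \<and> (\<exists>\<eta>\<in>set \<eta>s. \<eta> (ys ! c) \<noteq> 0)} < length \<eta>s"
  shows "wedge (\<xi>s @ \<eta>s) ys = 0"
proof (cases "length ys = length (\<xi>s @ \<eta>s)")
  case True
  let ?C = "{c. c < length ys \<and> (\<exists>\<eta>\<in>set \<eta>s. \<eta> (ys ! c) \<noteq> 0)}"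
  let ?m = "length (\<xi>s @ \<eta>s)" and ?R = "{length \<xi>s..<length (\<xi>s @ \<eta>s)}"
  let ?M = "mat ?m ?m (\<lambda>(i, j). ((\<xi>s @ \<eta>s) ! i) (ys ! j))"
  have "(\<Prod>i = 0..<?m. ?M $$ (i, \<pi> i)) = 0" if \<pi>: "\<pi> permutes {0..<?m}" for \<pi>
  proof -
    have "\<exists>i\<in>?R. \<pi> i \<notin> ?C"
    proof (rule ccontr)
      assume "\<not> ?thesis"
      then have "card ?R \<le> card ?C"
        using permutes_inj_on[OF \<pi>] by (intro card_inj_on_le[of \<pi>]) auto
      with assms show False by simp
    qed
    then obtain i where i: "i \<in> ?R" "\<pi> i \<notin> ?C" by blast
    have "\<pi> i < ?m"
      using \<pi> i(1) permutes_in_image[OF \<pi>, of i] by auto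
    then have "?M $$ (i, \<pi> i) = 0"
      using i True by (auto simp: nth_append)
    then show ?thesis using i(1) by (intro prod_zero bexI[of _ i]) auto
  qed
  then have "det ?M = 0"
    by (subst det_def'[of _ ?m]) (auto intro!: sum.neutral)
  then show ?thesis using True by (simp add: wedge_def)
qed (simp add: wedge_def)

section \<open>Tensor products of functionals and sums over multi-indices\<close>

definition tensor_eval :: "('v \<Rightarrow> complex) list \<Rightarrow> 'v list \<Rightarrow> complex" where
  "tensor_eval \<xi>s ys = prod_list (map2 (\<lambda>\<xi> y. \<xi> y) \<xi>s ys)"

lemma tensor_eval_Nil [simp]: "tensor_eval [] ys = 1"
  by (simp add: tensor_eval_def)

lemma tensor_eval_Cons [simp]: "tensor_eval (\<xi> # \<xi>s) (y # ys) = \<xi> y * tensor_eval \<xi>s ys"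
  by (simp add: tensor_eval_def)

lemma tensor_eval_append:
  "length \<xi>s = length ys \<Longrightarrow> tensor_eval (\<xi>s @ \<xi>s') (ys @ ys') = tensor_eval \<xi>s ys * tensor_eval \<xi>s' ys'"
  by (simp add: tensor_eval_def)

lemma tensor_eval_comp:
  "tensor_eval \<xi>s (map T ys) = tensor_eval (map (\<lambda>\<xi>. \<xi> \<circ> T) \<xi>s) ys"
  by (simp add: tensor_eval_def zip_map1 zip_map2 split_def comp_def)

lemma sum_lists_length_Suc:
  "(\<Sum>I\<in>{I. length I = Suc m \<and> set I \<subseteq> A}. F I) = (\<Sum>i\<in>A. \<Sum>I\<in>{I. length I = m \<and> set I \<subseteq> A}. F (i # I))"
proof -
  have "{I. length I = Suc m \<and> set I \<subseteq> A} = (\<lambda>(i, I). i # I) ` (A \<times> {I. length I = m \<and> set I \<subseteq> A})"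
    by (auto simp: length_Suc_conv image_iff)
  moreover have "inj_on (\<lambda>(i, I). i # I) (A \<times> {I. length I = m \<and> set I \<subseteq> A})"
    by (auto simp: inj_on_def)
  ultimately show ?thesis
    by (simp add: sum.reindex sum.cartesian_product split_def)
qed

text \<open>Expanding every functional in the dual basis and multiplying out gives one term per
  multi-index, repetitions and all orders included, so no factorial appears. The prefix
  \<open>A\<close> collects the dual functionals already chosen, which carries the
  induction.\<close>

lemma sum_tensor_eval_wedge:
  assumes basis: "is_basis n x" and "\<And>\<xi>. \<xi> \<in> set \<xi>s \<Longrightarrow> Vector_Spaces.linear scaleC (*) \<xi>"
  shows "(\<Sum>I\<in>{I. length I = length \<xi>s \<and> set I \<subseteq> {1..n}}.
      tensor_eval \<xi>s (map x I) * wedge (A @ map (dual n x) I) ys) = wedge (A @ \<xi>s) ys"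
  using assms(2)
proof (induction \<xi>s arbitrary: A)
  case Nil
  have "{I :: nat list. I = [] \<and> set I \<subseteq> {1..n}} = {[]}" by auto
  then show ?case by simp
next
  case (Cons \<xi> \<xi>s)
  interpret \<xi>: Vector_Spaces.linear scaleC "(*)" \<xi> using Cons.prems by simp
  have expand: "\<xi> y = (\<Sum>i = 1..n. \<xi> (x i) * dual n x i y)" for y
  proof -
    have "\<xi> y = \<xi> (\<Sum>i = 1..n. dual n x i y *\<^sub>C x i)"
      by (simp only: dual_expansion[OF basis])
    then show ?thesis by (simp add: \<xi>.sum \<xi>.scale mult.commute)
  qed
  let ?S = "{I. length I = length \<xi>s \<and> set I \<subseteq> {1..n}}"
  have "(\<Sum>I\<in>{I. length I = length (\<xi> # \<xi>s) \<and> set I \<subseteq> {1..n}}.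
      tensor_eval (\<xi> # \<xi>s) (map x I) * wedge (A @ map (dual n x) I) ys)
    = (\<Sum>i = 1..n. \<Sum>I\<in>?S.
      tensor_eval (\<xi> # \<xi>s) (map x (i # I)) * wedge (A @ map (dual n x) (i # I)) ys)"
    unfolding length_Cons by (rule sum_lists_length_Suc)
  also have "\<dots> = (\<Sum>i = 1..n. \<xi> (x i) * (\<Sum>I\<in>?S.
      tensor_eval \<xi>s (map x I) * wedge ((A @ [dual n x i]) @ map (dual n x) I) ys))"
    by (simp only: list.map tensor_eval_Cons sum_distrib_left mult.assoc append_assoc append.simps)
  also have "\<dots> = (\<Sum>i = 1..n. \<xi> (x i) * wedge ((A @ [dual n x i]) @ \<xi>s) ys)"
    using Cons.prems by (intro sum.cong refl arg_cong2[where f = "(*)"] Cons.IH) auto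
  also have "\<dots> = wedge (A @ \<xi> # \<xi>s) ys"
    by (simp add: wedge_row_sum[OF expand])
  finally show ?case .
qed

text \<open>For \<open>J' = J\<close> the matrix is the identity; otherwise some index of
  \<open>J\<close> is missing from \<open>J'\<close> and its row is zero.\<close>

lemma dform_basis:
  assumes basis: "is_basis n x" and J: "J \<in> increasing n p" "J' \<in> increasing n p"
  shows "dform n x J (map x J') = (if J' = J then 1 else 0)"
proof (cases "J' = J")
  case True
  have "distinct J"
    using J by (auto simp: increasing_def strict_sorted_iff)
  then have "mat (length J) (length J) (\<lambda>(i, j). (map (dual n x) J ! i) (map x J ! j)) = 1\<^sub>m (length J)"
    using J by (intro eq_matI)
      (auto simp: increasing_def subset_iff dual_basis[OF basis] nth_eq_iff_index_eq)
  then show ?thesis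
    using True by (simp add: dform_def wedge_def)
next
  case False
  have sd: "sorted J" "distinct J" "sorted J'" "distinct J'" "length J = p" "length J' = p"
    using J by (auto simp: increasing_def strict_sorted_iff)
  \<comment> \<open>An inclusion between index sets of the same size is an equality, and increasing
    lists are determined by their sets.\<close>
  have "\<not> set J \<subseteq> set J'"
  proof
    assume "set J \<subseteq> set J'"
    then have "set J = set J'"
      using sd by (intro card_subset_eq) (auto simp: distinct_card)
    then show False using False sd sorted_distinct_set_unique by metis
  qed
  then obtain l where l: "l \<in> set J" "l \<notin> set J'" by blast
  have "wedge (map (dual n x) J) (map x J') = 0"
  proof (rule wedge_row_zero)
    show "dual n x l \<in> set (map (dual n x) J)" using l by simp
    fix y assume "y \<in> set (map x J')"
    then obtain i where "y = x i" "i \<in> set J'" by auto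
    with l J show "dual n x l y = 0"
      by (auto simp: increasing_def subset_iff dual_basis[OF basis])
  qed
  then show ?thesis using False by (simp add: dform_def)
qed

text \<open>Generalized Laplace expansion, one row at a time: the rows \<open>v\<^sub>l\<^sup>*\<close> are unit vectors.\<close>

lemma wedge_dual_rows:
  assumes basis: "is_basis n x"
    and "sorted_wrt (<) L" "sorted_wrt (<) I" "set I \<subseteq> {1..n}"
    and "\<And>s. s < length L \<Longrightarrow> pos s < length I \<and> I ! pos s = L ! s"
  shows "wedge (A @ map (dual n x) L @ B) (map x I) =
    (-1) ^ (\<Sum>s<length L. length A + s + pos s) * wedge (A @ B) (map x (filter (\<lambda>i. i \<notin> set L) I))"
  using assms(2-)
\<comment> \<open>The last row of \<open>L\<close> is expanded first: entries of \<open>L\<close>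
  before it sit further left in \<open>I\<close>, so deleting its column leaves their positions
  \<open>pos s\<close> unchanged.\<close>
proof (induction L arbitrary: I rule: rev_induct)
  case Nil
  then show ?case by simp
next
  case (snoc l L)
  let ?c = "pos (length L)"
  define I' where "I' = take ?c I @ drop (Suc ?c) I"
  have c: "?c < length I" "I ! ?c = l"
    using snoc.prems(4)[of "length L"] by auto
  have I: "I = take ?c I @ l # drop (Suc ?c) I"
    using id_take_nth_drop[OF c(1)] c(2) by simp
  have distinct: "distinct I"
    using snoc.prems(2) by (simp add: strict_sorted_iff)
  have I_mem: "I ! d \<in> {1..n}" if "d < length I" for d
    using that snoc.prems(3) nth_mem by blast
  have "wedge ((A @ map (dual n x) L) @ dual n x l # B) (map x I) =
      (-1) ^ (length (A @ map (dual n x) L) + ?c)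
      * wedge ((A @ map (dual n x) L) @ B) (take ?c (map x I) @ drop (Suc ?c) (map x I))"
  proof (rule wedge_row_unit)
    fix d assume "d < length (map x I)"
    then show "dual n x l (map x I ! d) = (if d = ?c then 1 else 0)"
      using c I_mem[of d] I_mem[of ?c] distinct by (auto simp: dual_basis[OF basis] nth_eq_iff_index_eq)
  qed (use c in simp)
  also have "\<dots> = (-1) ^ (length A + length L + ?c) * wedge (A @ map (dual n x) L @ B) (map x I')"
    by (simp add: I'_def take_map drop_map)
  also have "wedge (A @ map (dual n x) L @ B) (map x I') =
    (-1) ^ (\<Sum>s<length L. length A + s + pos s) * wedge (A @ B) (map x (filter (\<lambda>i. i \<notin> set L) I'))"
  proof (rule snoc.IH)
    show "sorted_wrt (<) L" using snoc.prems(1) by (simp add: sorted_wrt_append)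
    show "sorted_wrt (<) I'"
      using snoc.prems(2) by (subst (asm) I) (simp add: I'_def sorted_wrt_append)
    show "set I' \<subseteq> {1..n}"
      using snoc.prems(3) by (auto simp: I'_def dest: in_set_takeD in_set_dropD)
    fix s assume s: "s < length L"
    then have pos: "pos s < length I" "I ! pos s = L ! s"
      using snoc.prems(4)[of s] by (auto simp: nth_append)
    have "L ! s < l"
      using snoc.prems(1) s by (auto simp: sorted_wrt_append)
    then have "pos s < ?c"
      using pos c snoc.prems(2) sorted_wrt_nth_less[OF snoc.prems(2), of ?c "pos s"]
      by (metis linorder_neqE_nat order_less_asym order_less_irrefl)
    then show "pos s < length I' \<and> I' ! pos s = L ! s"
      using pos c by (auto simp: I'_def nth_append)
  qed
  also have "filter (\<lambda>i. i \<notin> set L) I' = filter (\<lambda>i. i \<notin> set (L @ [l])) I"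
  proof -
    have "l \<notin> set I'"
      using distinct by (subst (asm) I) (simp add: I'_def)
    then have "filter (\<lambda>i. i \<notin> set L) I' = filter (\<lambda>i. i \<notin> set (L @ [l])) I'"
      by (intro filter_cong) auto
    also have "\<dots> = filter (\<lambda>i. i \<notin> set (L @ [l])) I"
      using arg_cong[OF I, of "filter (\<lambda>i. i \<notin> set (L @ [l]))"] by (simp add: I'_def)
    finally show ?thesis .
  qed
  finally show ?case
    by (simp add: power_add mult_ac)
qed

section \<open>The circle product\<close>

lemma eigenvalue_eq:
  assumes "x \<noteq> (0 :: 'v::complex_vector)" "T x = c *\<^sub>C x"
  shows "eigenvalue T x = c"
  unfolding eigenvalue_def using assms by (intro the_equality) auto

text \<open>The eigenvalues found by \<open>eigenvalue\<close> are known to agree with the given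
  ones only on \<open>{1..n}\<close>; as \<open>j \<le> n\<close>, the product over
  \<open>[1..<j]\<close> reads nothing outside it.\<close>

lemma slot_partial_cong:
  assumes "\<And>i. i \<in> {1..n} \<Longrightarrow> e i = e' i" "j \<in> {1..n}"
  shows "slot_partial n x e j = slot_partial n x e' j"
proof -
  have eq: "map (\<lambda>i. diag_slot n x i (e i)) [1..<j] = map (\<lambda>i. diag_slot n x i (e' i)) [1..<j]"
    using assms by (intro map_cong refl) auto
  have "slot_prod n x e j = slot_prod n x e' j"
    unfolding slot_prod_def eq ..
  then show ?thesis
    using assms(1)[OF assms(2)] by (intro ext) (simp add: slot_partial_def)
qed

lemma prod_slot_partial_sym_incl:
  assumes "is_basis n x" "length J = length ys" "set J \<subseteq> {1..n}"
  shows "prod_list (map2 (slot_partial n x e) J (map sym_incl ys)) = tensor_eval (map (dual n x) J) ys *\<^sub>C 1"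
  using assms(2,3)
  by (induction J ys rule: list_induct2) (simp_all add: slot_partial_sym_incl[OF assms(1)])

lemma finite_increasing: "finite (increasing n p)"
  by (rule finite_subset[OF _ finite_lists_length_eq[of "{1..n}" p]]) (auto simp: increasing_def)

lemma increasing_nth_mem: "J \<in> increasing n p \<Longrightarrow> k < p \<Longrightarrow> J ! k \<in> {1..n}"
  unfolding increasing_def using nth_mem by blast

text \<open>The forms \<open>dform n x J\<close> are dual to the increasing tuples of basis vectors,
  so only the term of \<open>J\<close> survives.\<close>

lemma Upsilon_tens:
  assumes basis: "is_basis n x" and J: "J \<in> increasing n p" and fs: "length fs = p"
    and e: "\<And>i. i \<in> {1..n} \<Longrightarrow> \<rho> g (x i) = e i *\<^sub>C x i"
  shows "Upsilon n \<rho> g x p (tens g f (dform n x J)) fs = prod_list (map2 (slot_partial n x e) J fs) * f"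
proof -
  let ?e = "\<lambda>i. eigenvalue (\<rho> g) (x i)"
  have "Upsilon n \<rho> g x p (tens g f (dform n x J)) fs =
      (\<Sum>J'\<in>increasing n p. (\<Prod>k<p. slot_partial n x ?e (J' ! k) (fs ! k))
        * Poly_Mapping.lookup (tens g f (dform n x J) (map x J')) g)"
    by (simp add: Upsilon_def slot_partial_def)
  also have "\<dots> = (\<Sum>J'\<in>increasing n p.
      if J' = J then (\<Prod>k<p. slot_partial n x ?e (J ! k) (fs ! k)) * f else 0)"
    by (intro sum.cong refl) (simp add: tens_def dform_basis[OF basis J])
  also have "\<dots> = (\<Prod>k<p. slot_partial n x ?e (J ! k) (fs ! k)) * f"
    using J finite_increasing by (simp add: sum.delta)
  also have "(\<Prod>k<p. slot_partial n x ?e (J ! k) (fs ! k)) = (\<Prod>k<p. slot_partial n x e (J ! k) (fs ! k))"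
  proof (rule prod.cong)
    fix k assume "k \<in> {..<p}"
    then have "J ! k \<in> {1..n}"
      by (intro increasing_nth_mem[OF J]) simp
    then have "slot_partial n x ?e (J ! k) = slot_partial n x e (J ! k)"
      by (intro slot_partial_cong) (auto intro!: eigenvalue_eq e basis_nonzero[OF basis])
    then show "slot_partial n x ?e (J ! k) (fs ! k) = slot_partial n x e (J ! k) (fs ! k)" by simp
  qed simp
  also have "\<dots> = prod_list (map2 (slot_partial n x e) J fs)"
    using J fs by (simp add: prod.list_conv_set_nth increasing_def atLeast0LessThan)
  finally show ?thesis .
qed

lemma single_sum: "Poly_Mapping.single k (sum F A) = (\<Sum>a\<in>A. Poly_Mapping.single k (F a))"
  by (induction A rule: infinite_finite_induct) (simp_all add: single_add)

lemma sums_of_sum: "finite K \<Longrightarrow> (\<And>k. k \<in> K \<Longrightarrow> \<gamma> k \<in> X) \<Longrightarrow> (\<lambda>ys. \<Sum>k\<in>K. \<gamma> k ys) \<in> sums_of X"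
proof (induction K rule: finite_induct)
  case empty
  then show ?case by (simp add: sums_of.zero)
next
  case (insert k K)
  then have "(\<lambda>ys. \<gamma> k ys + (\<Sum>k\<in>K. \<gamma> k ys)) \<in> sums_of X"
    by (intro sums_of.add) auto
  with insert show ?case by simp
qed

text \<open>The functionals whose wedge product is the \<open>k\<close>th summand of the circle product.\<close>

definition circ_forms ::
  "nat \<Rightarrow> ('v \<Rightarrow> 'v) \<Rightarrow> (nat \<Rightarrow> 'v::complex_vector) \<Rightarrow> (nat \<Rightarrow> 'v) \<Rightarrow> nat list \<Rightarrow> nat list \<Rightarrow> nat
    \<Rightarrow> ('v \<Rightarrow> complex) list" where
  "circ_forms n T w v J L k =
     map (dual n w) (take (k - 1) J) @ map (dual n v) L @ map (\<lambda>j. dual n w j \<circ> T) (drop k J)"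

text \<open>The inner \<open>Upsilon\<close> receives only vectors, so it is a scalar multiple of
  \<open>f'\<close>. The scalar passes through slot \<open>k\<close> of the outer one by
  homogeneity, and the remaining slots again receive vectors and contribute scalars.\<close>

lemma Upsilon_Upsilon_tens:
  assumes w: "is_basis n w" and v: "is_basis n v"
    and \<epsilon>: "\<And>i. i \<in> {1..n} \<Longrightarrow> \<rho> g (w i) = \<epsilon> i *\<^sub>C w i"
    and \<eta>: "\<And>i. i \<in> {1..n} \<Longrightarrow> \<rho> h (v i) = \<eta> i *\<^sub>C v i"
    and J: "J \<in> increasing n p" and L: "L \<in> increasing n q"
    and k: "k \<in> {1..p}" and I: "length I = p + q - 1"
  shows "Upsilon n \<rho> g w p (tens g f (dform n w J))
      (map (\<lambda>i. sym_incl (u i)) (take (k - 1) I)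
        @ [Upsilon n \<rho> h v q (tens h f' (dform n v L)) (map (\<lambda>i. sym_incl (u i)) (take q (drop (k - 1) I)))]
        @ map (\<lambda>i. sym_incl (\<rho> h (u i))) (drop (k + q - 1) I))
    = tensor_eval (circ_forms n (\<rho> h) w v J L k) (map u I) *\<^sub>C (slot_partial n w \<epsilon> (J ! (k - 1)) f' * f)"
proof -
  \<comment> \<open>The multi-index splits into the arguments before slot \<open>k\<close>, those
    fed to the inner \<open>Upsilon\<close> and those after, matching \<open>J1\<close>,
    \<open>L\<close> and \<open>J2\<close> below.\<close>
  define I1 I2 I3 where "I1 = take (k - 1) I" "I2 = take q (drop (k - 1) I)" "I3 = drop (k + q - 1) I"
  have I_split: "I = I1 @ I2 @ I3"
  proof -
    have "k + q - 1 = q + (k - 1)" using k by auto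
    then have "I2 @ I3 = drop (k - 1) I"
      by (simp add: I1_I2_I3_def drop_drop[symmetric] del: drop_drop)
    then show ?thesis by (simp add: I1_I2_I3_def)
  qed
  define J1 J2 j where "J1 = take (k - 1) J" "J2 = drop k J" "j = J ! (k - 1)"
  have len: "length J = p" "length L = q" using J L by (auto simp: increasing_def)
  have "k - 1 < length J" using k len by auto
  then have J_split: "J = J1 @ j # J2"
    using id_take_nth_drop[of "k - 1" J] k by (simp add: J1_J2_j_def)
  have lens: "length I1 = length J1" "length I2 = length L" "length I3 = length J2"
    using k I len by (auto simp: I1_I2_I3_def J1_J2_j_def)
  have p: "p = Suc (length J1 + length J2)"
    using len(1) J_split by simp
  have sets: "set J1 \<subseteq> {1..n}" "set J2 \<subseteq> {1..n}" "j \<in> {1..n}" "set L \<subseteq> {1..n}"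
    using J L by (auto simp: increasing_def J_split)
  let ?F = "Upsilon n \<rho> h v q (tens h f' (dform n v L)) (map (\<lambda>i. sym_incl (u i)) I2)"
  have "?F = prod_list (map2 (slot_partial n v \<eta>) L (map sym_incl (map u I2))) * f'"
    using lens len by (subst Upsilon_tens[where e = \<eta>]) (simp_all add: v L \<eta> comp_def)
  also have "\<dots> = tensor_eval (map (dual n v) L) (map u I2) *\<^sub>C f'"
    using lens sets by (subst prod_slot_partial_sym_incl[OF v]) simp_all
  finally have F: "?F = tensor_eval (map (dual n v) L) (map u I2) *\<^sub>C f'" .
  have "Upsilon n \<rho> g w p (tens g f (dform n w J))
      (map (\<lambda>i. sym_incl (u i)) I1 @ [?F] @ map (\<lambda>i. sym_incl (\<rho> h (u i))) I3)
    = prod_list (map2 (slot_partial n w \<epsilon>) J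
      (map sym_incl (map u I1) @ [?F] @ map sym_incl (map (\<rho> h) (map u I3)))) * f"
    using lens p J by (subst Upsilon_tens[where e = \<epsilon>]) (simp_all add: w J \<epsilon> comp_def)
  also have "prod_list (map2 (slot_partial n w \<epsilon>) J
      (map sym_incl (map u I1) @ [?F] @ map sym_incl (map (\<rho> h) (map u I3)))) =
    prod_list (map2 (slot_partial n w \<epsilon>) J1 (map sym_incl (map u I1)))
      * (slot_partial n w \<epsilon> j ?F
      * prod_list (map2 (slot_partial n w \<epsilon>) J2 (map sym_incl (map (\<rho> h) (map u I3)))))"
    using lens by (simp add: J_split del: map_map)
  also have "prod_list (map2 (slot_partial n w \<epsilon>) J1 (map sym_incl (map u I1)))
      = tensor_eval (map (dual n w) J1) (map u I1) *\<^sub>C 1"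
    using lens sets by (intro prod_slot_partial_sym_incl w) simp_all
  also have "prod_list (map2 (slot_partial n w \<epsilon>) J2 (map sym_incl (map (\<rho> h) (map u I3))))
      = tensor_eval (map (dual n w) J2) (map (\<rho> h) (map u I3)) *\<^sub>C 1"
    using lens sets by (intro prod_slot_partial_sym_incl w) simp_all
  \<comment> \<open>The action of \<open>h\<close> moves from the vectors to the functionals, which
    accounts for the composition in \<open>circ_forms\<close>.\<close>
  also have "tensor_eval (map (dual n w) J2) (map (\<rho> h) (map u I3))
      = tensor_eval (map (\<lambda>j. dual n w j \<circ> \<rho> h) J2) (map u I3)"
    by (subst tensor_eval_comp) (simp add: comp_def)
  also have "slot_partial n w \<epsilon> j ?F = tensor_eval (map (dual n v) L) (map u I2) *\<^sub>C slot_partial n w \<epsilon> j f'"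
    unfolding F using sets by (intro slot_partial_scale w) simp
  also have "tensor_eval (map (dual n w) J1) (map u I1) *\<^sub>C 1
      * (tensor_eval (map (dual n v) L) (map u I2) *\<^sub>C slot_partial n w \<epsilon> j f'
      * tensor_eval (map (\<lambda>j. dual n w j \<circ> \<rho> h) J2) (map u I3) *\<^sub>C 1) * f =
    tensor_eval (circ_forms n (\<rho> h) w v J L k) (map u I) *\<^sub>C (slot_partial n w \<epsilon> j f' * f)"
  proof -
    have "tensor_eval (circ_forms n (\<rho> h) w v J L k) (map u I) =
        tensor_eval (map (dual n w) J1) (map u I1) * (tensor_eval (map (dual n v) L) (map u I2)
        * tensor_eval (map (\<lambda>j. dual n w j \<circ> \<rho> h) J2) (map u I3))"
      unfolding circ_forms_def J1_J2_j_def(1,2)[symmetric] I_split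
      using lens by (simp add: tensor_eval_append)
    then show ?thesis by (simp add: mult_ac)
  qed
  finally show ?thesis unfolding I1_I2_I3_def J1_J2_j_def .
qed

text \<open>In the summand for \<open>k\<close> the multi-index enters only through a tensor product
  of functionals and \<open>dform n u I\<close>. After exchanging the sums,
  \<open>sum_tensor_eval_wedge\<close> turns this into a wedge product and eliminates
  \<open>u\<close>.\<close>

lemma circ_tens:
  assumes w: "is_basis n w" and v: "is_basis n v" and u: "is_basis n u" and T: "clinear (\<rho> h)"
    and \<epsilon>: "\<And>i. i \<in> {1..n} \<Longrightarrow> \<rho> g (w i) = \<epsilon> i *\<^sub>C w i"
    and \<eta>: "\<And>i. i \<in> {1..n} \<Longrightarrow> \<rho> h (v i) = \<eta> i *\<^sub>C v i"
    and J: "J \<in> increasing n p" and L: "L \<in> increasing n q"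
  shows "circ n G \<rho> g h w v u p q (tens g f (dform n w J)) (tens h f' (dform n v L)) =
    (\<lambda>ys. \<Sum>k = 1..p. tens (g \<otimes>\<^bsub>G\<^esub> h)
      (((-1) powi ((int q - 1) * (int k - 1))) *\<^sub>C (slot_partial n w \<epsilon> (J ! (k - 1)) f' * f))
      (wedge (circ_forms n (\<rho> h) w v J L k)) ys)"
proof
  fix ys
  let ?S = "{I. length I = p + q - 1 \<and> set I \<subseteq> {1..n}}"
  let ?c = "\<lambda>k. (-1) powi ((int q - 1) * (int k - 1)) :: complex"
  let ?X = "\<lambda>k. slot_partial n w \<epsilon> (J ! (k - 1)) f' * f"
  let ?\<xi>s = "circ_forms n (\<rho> h) w v J L"
  have len: "length (?\<xi>s k) = p + q - 1" if "k \<in> {1..p}" for k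
    using that J L by (auto simp: circ_forms_def increasing_def)
  have lin: "Vector_Spaces.linear scaleC (*) \<xi>" if "\<xi> \<in> set (?\<xi>s k)" for \<xi> k
    using that linear_dual[OF w] linear_dual[OF v] Vector_Spaces.linear_compose[OF T linear_dual[OF w]]
    by (auto simp: circ_forms_def)
  have "circ n G \<rho> g h w v u p q (tens g f (dform n w J)) (tens h f' (dform n v L)) ys =
    (\<Sum>I\<in>?S. \<Sum>k = 1..p. tens (g \<otimes>\<^bsub>G\<^esub> h)
      (?c k *\<^sub>C (tensor_eval (?\<xi>s k) (map u I) *\<^sub>C ?X k)) (dform n u I) ys)"
    unfolding circ_def
    by (intro sum.cong refl arg_cong2[where f = "\<lambda>F. tens (g \<otimes>\<^bsub>G\<^esub> h) (_ *\<^sub>C F)"]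
        arg_cong[where f = "\<lambda>F. tens _ (_ *\<^sub>C F) _ _"] Upsilon_Upsilon_tens[OF w v])
      (auto simp: \<epsilon> \<eta> J L)
  also have "\<dots> = (\<Sum>k = 1..p. \<Sum>I\<in>?S. Poly_Mapping.single (g \<otimes>\<^bsub>G\<^esub> h)
      ((tensor_eval (?\<xi>s k) (map u I) * dform n u I ys) *\<^sub>C ?c k *\<^sub>C ?X k))"
    by (subst sum.swap) (simp add: tens_def mult_ac)
  also have "\<dots> = (\<Sum>k = 1..p. Poly_Mapping.single (g \<otimes>\<^bsub>G\<^esub> h)
      ((\<Sum>I\<in>?S. tensor_eval (?\<xi>s k) (map u I) * dform n u I ys) *\<^sub>C ?c k *\<^sub>C ?X k))"
    by (simp only: single_sum cvec.scale_sum_left)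
  also have "\<dots> = (\<Sum>k = 1..p. Poly_Mapping.single (g \<otimes>\<^bsub>G\<^esub> h) (wedge (?\<xi>s k) ys *\<^sub>C ?c k *\<^sub>C ?X k))"
  proof (intro sum.cong refl)
    fix k assume "k \<in> {1..p}"
    then have "(\<Sum>I\<in>?S. tensor_eval (?\<xi>s k) (map u I) * dform n u I ys) = wedge (?\<xi>s k) ys"
      using sum_tensor_eval_wedge[OF u, of "?\<xi>s k" "[]" ys] lin by (simp add: len dform_def)
    then show "Poly_Mapping.single (g \<otimes>\<^bsub>G\<^esub> h)
        ((\<Sum>I\<in>?S. tensor_eval (?\<xi>s k) (map u I) * dform n u I ys) *\<^sub>C ?c k *\<^sub>C ?X k) =
      Poly_Mapping.single (g \<otimes>\<^bsub>G\<^esub> h) (wedge (?\<xi>s k) ys *\<^sub>C ?c k *\<^sub>C ?X k)" by simp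
  qed
  finally show "circ n G \<rho> g h w v u p q (tens g f (dform n w J)) (tens h f' (dform n v L)) ys =
    (\<Sum>k = 1..p. tens (g \<otimes>\<^bsub>G\<^esub> h) (?c k *\<^sub>C ?X k) (wedge (?\<xi>s k)) ys)"
    by (simp only: tens_def)
qed

section \<open>The support of elements of \<open>H_cochains\<close>\<close>

lemma codim_fixed_space:
  assumes v: "is_basis n v" and T: "clinear T"
    and \<eta>: "\<And>i. i \<in> {1..n} \<Longrightarrow> T (v i) = \<eta> i *\<^sub>C v i"
  shows "codim (fixed_space T) = card {i \<in> {1..n}. \<eta> i \<noteq> 1}"
proof -
  let ?E = "{i \<in> {1..n}. \<eta> i = 1}"
  have ind: "cvec.independent (v ` {1..n})" and inj: "inj_on v {1..n}" and "cvec.span (v ` {1..n}) = UNIV"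
    using v by (auto simp: is_basis_def)
  then have "cvec.dim (UNIV :: 'a set) = card (v ` {1..n})"
    by (intro cvec.dim_eq_card) auto
  then have dim_V: "cvec.dim (UNIV :: 'a set) = n"
    using inj by (simp add: card_image)
  have "cvec.dim (fixed_space T) = card ?E"
  proof (rule cvec.dim_unique)
    show "v ` ?E \<subseteq> fixed_space T"
      by (auto simp: fixed_space_def \<eta>)
    show "cvec.independent (v ` ?E)"
      using ind by (rule cvec.independent_mono) auto
    show "card (v ` ?E) = card ?E"
      using inj by (intro card_image) (auto elim: inj_on_subset)
    show "fixed_space T \<subseteq> cvec.span (v ` ?E)"
    proof
      fix y assume "y \<in> fixed_space T"
      then have y: "T y = y" by (simp add: fixed_space_def)
      \<comment> \<open>Comparing \<open>i\<close>th coordinates in \<open>T y = y\<close> gives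
        \<open>dual n v i y * \<eta> i = dual n v i y\<close>, so coordinates outside
        \<open>?E\<close> vanish.\<close>
      have "dual n v i y = 0" if i: "i \<in> {1..n}" "\<eta> i \<noteq> 1" for i
      proof -
        interpret d: Vector_Spaces.linear scaleC "(*)" "dual n v i" by (rule linear_dual[OF v])
        have "T y = T (\<Sum>j = 1..n. dual n v j y *\<^sub>C v j)"
          by (simp only: dual_expansion[OF v])
        also have "\<dots> = (\<Sum>j = 1..n. (dual n v j y * \<eta> j) *\<^sub>C v j)"
          by (simp add: clinear_sum[OF T] clinear_scale[OF T] \<eta>)
        finally have "dual n v i (T y) = (\<Sum>j = 1..n. (dual n v j y * \<eta> j) * dual n v i (v j))"
          by (simp add: d.sum d.scale)
        also have "\<dots> = (\<Sum>j = 1..n. if j = i then dual n v i y * \<eta> i else 0)"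
          by (intro sum.cong refl) (use i in \<open>simp add: dual_basis[OF v]\<close>)
        finally have "dual n v i y = dual n v i y * \<eta> i"
          using i y by simp
        then show ?thesis using i by simp
      qed
      then have "(\<Sum>i = 1..n. dual n v i y *\<^sub>C v i) \<in> cvec.span (v ` ?E)"
        by (intro cvec.span_sum) (metis (mono_tags, lifting) cvec.scale_zero_left cvec.span_base
          cvec.span_scale cvec.span_zero image_eqI mem_Collect_eq)
      then show "y \<in> cvec.span (v ` ?E)"
        by (simp only: dual_expansion[OF v])
    qed
  qed
  moreover have "card {i \<in> {1..n}. \<eta> i \<noteq> 1} = n - card ?E"
  proof -
    have "{i \<in> {1..n}. \<eta> i \<noteq> 1} = {1..n} - ?E" by auto
    moreover have "card ({1..n} - ?E) = card {1..n} - card ?E"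
      by (intro card_Diff_subset) auto
    ultimately show ?thesis by simp
  qed
  ultimately show ?thesis
    using dim_V by (simp only: codim_def)
qed

text \<open>
  The last \<open>codim V\<^sup>h\<close> factors of an element of \<open>H\<close> vanish on \<open>V\<^sup>h\<close>, so its value at \<open>v\<^sub>L\<close> is a sum of
  determinants with a zero block, which is too large as soon as \<open>L\<close> misses an eigenvector outside \<open>V\<^sup>h\<close>.
\<close>

lemma H_cochains_support:
  assumes v: "is_basis n v" and T: "clinear (\<rho> h)"
    and \<eta>: "\<And>i. i \<in> {1..n} \<Longrightarrow> \<rho> h (v i) = \<eta> i *\<^sub>C v i"
    and L: "L \<in> increasing n q"
    and \<gamma>: "\<gamma> \<in> H_cochains ip \<rho> q h" "\<gamma> (map v L) \<noteq> 0"
  shows "{i \<in> {1..n}. \<eta> i \<noteq> 1} \<subseteq> set L"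
proof (rule ccontr)
  let ?N = "{i \<in> {1..n}. \<eta> i \<noteq> 1}" and ?U = "fixed_space (\<rho> h)"
  assume not_sub: "\<not> ?N \<subseteq> set L"
  have L_mem: "L ! c \<in> {1..n}" if "c < length L" for c
    using L that by (intro increasing_nth_mem[OF L]) (simp add: increasing_def)
  have wedge_0: "wedge (\<xi>s @ \<eta>s) (map v L) = 0"
    if "length \<eta>s = codim ?U" "set \<eta>s \<subseteq> functionals_vanishing_on ?U" for \<xi>s \<eta>s :: "('a \<Rightarrow> complex) list"
  proof (rule wedge_zero_block)
    let ?C = "{c. c < length (map v L) \<and> (\<exists>\<eta>\<in>set \<eta>s. \<eta> (map v L ! c) \<noteq> 0)}"
    have "(\<lambda>c. L ! c) ` ?C \<subseteq> ?N \<inter> set L"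
    proof
      fix l assume "l \<in> (\<lambda>c. L ! c) ` ?C"
      then obtain c \<theta> where c: "c < length L" "l = L ! c" "\<theta> \<in> set \<eta>s" "\<theta> (v l) \<noteq> 0" by auto
      then have "v l \<notin> ?U"
        using that(2) by (auto simp: functionals_vanishing_on_def)
      then show "l \<in> ?N \<inter> set L"
        using c L_mem[of c] \<eta>[of l] by (auto simp: fixed_space_def)
    qed
    moreover have "inj_on (\<lambda>c. L ! c) ?C"
      using L by (auto simp: increasing_def strict_sorted_iff inj_on_def nth_eq_iff_index_eq)
    ultimately have "card ?C \<le> card (?N \<inter> set L)"
      by (metis (no_types, lifting) card_image card_mono finite_Int finite_set)
    also have "\<dots> < card ?N"
      using not_sub by (intro psubset_card_mono) auto
    finally show "card ?C < length \<eta>s"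
      using that(1) codim_fixed_space[OF v T \<eta>] by simp
  qed
  have "\<gamma> (map v L) = 0"
    using \<gamma>(1) unfolding H_cochains_def Let_def
  proof (induction rule: sums_of.induct)
    case zero
    then show ?case by simp
  next
    case (add \<gamma> \<delta>)
    then show ?case by (auto simp: tens_def wedge_0)
  qed
  with \<gamma>(2) show False by simp
qed

section \<open>Signs and minors\<close>

lemma minus_one_powi: "(-1 :: complex) powi k = (if even k then 1 else -1)"
  by (cases "k \<ge> 0") (auto simp: power_int_def even_nat_iff minus_one_power_iff)

lemma minus_one_power_powi: "(-1 :: complex) ^ k = (-1) powi (int k)"
  by simp

lemma sum_lessThan_choose: "(\<Sum>s<q. s) = q choose 2"
  by (induction q) (simp_all add: numeral_2_eq_2)

text \<open>The first sign comes from the circle product, the second from the Laplace expansion with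
  rows and columns counted from 0: the row of \<open>v\<^sub>l\<^sup>*\<close> follows
  \<open>k - 1\<close> rows of \<open>w\<close>, and \<open>lam\<close> counts from 1. The total
  exponent and \<nu> have the same parity.\<close>

lemma laplace_sign:
  assumes "k \<ge> 1" and "\<And>s. s \<in> {1..q} \<Longrightarrow> lam s \<ge> 1"
  shows "(-1 :: complex) powi ((int q - 1) * (int k - 1)) * (-1) ^ (\<Sum>s<q. (k - 1) + s + (lam (Suc s) - 1))
    = (-1) powi (1 - int q - int k + (\<Sum>s = 1..q. int (lam s)) - int (q choose 2))"
proof -
  let ?S = "\<Sum>s = 1..q. int (lam s)" and ?N = "\<Sum>s<q. (k - 1) + s + (lam (Suc s) - 1)"
  \<comment> \<open>The bounds \<open>k \<ge> 1\<close> and \<open>lam (Suc s) \<ge> 1\<close> make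
    the truncated subtractions agree with those of integers.\<close>
  have "int ((k - 1) + s + (lam (Suc s) - 1)) = (int k - 1) + int s + (int (lam (Suc s)) - 1)"
    if "s < q" for s
    using assms(1) assms(2)[of "Suc s"] that by auto
  then have "int ?N = (\<Sum>s<q. (int k - 1) + int s + (int (lam (Suc s)) - 1))"
    unfolding of_nat_sum by (intro sum.cong refl) (simp only: lessThan_iff)
  also have "\<dots> = int q * (int k - 1) + int (\<Sum>s<q. s) + ((\<Sum>s<q. int (lam (Suc s))) - int q)"
    by (simp add: sum.distrib sum_subtractf right_diff_distrib)
  also have "(\<Sum>s<q. int (lam (Suc s))) = ?S"
    by (simp add: sum.atLeast1_atMost_eq)
  finally have N: "int ?N = int q * (int k - 1) + int (q choose 2) + (?S - int q)"
    by (simp only: sum_lessThan_choose)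
  \<comment> \<open>The two exponents differ by twice \<open>q (k - 1)\<close> plus the binomial
    coefficient, so only parity remains to be compared.\<close>
  have "(int q - 1) * (int k - 1) + int ?N =
      (1 - int q - int k + ?S - int (q choose 2)) + 2 * (int q * (int k - 1) + int (q choose 2))"
    unfolding N by (simp add: algebra_simps)
  then have "even ((int q - 1) * (int k - 1) + int ?N) \<longleftrightarrow> even (1 - int q - int k + ?S - int (q choose 2))"
    by presburger
  then show ?thesis
    by (simp only: minus_one_power_powi minus_one_powi even_add if_distrib[of "times _"]) auto
qed

text \<open>Column \<open>i\<close> of \<open>a\<close> lists the coordinates of \<open>v i\<close>
  in the basis \<open>w\<close>, so evaluating dual functionals of \<open>w\<close> on vectors of
  \<open>v\<close> reads off entries of \<open>a\<close>.\<close>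

lemma wedge_dual_eq_minor:
  assumes w: "is_basis n w"
    and a: "\<And>i. i \<in> {1..n} \<Longrightarrow> v i = (\<Sum>j = 1..n. a j i *\<^sub>C w j)"
    and "set R \<subseteq> {1..n}" "set C \<subseteq> {1..n}" "length R = length C"
  shows "wedge (map (dual n w) R) (map v C) = det (mat (length R) (length C) (\<lambda>(r, c). a (R ! r) (C ! c)))"
proof -
  have "dual n w j (v i) = a j i" if "i \<in> {1..n}" "j \<in> {1..n}" for i j
  proof -
    interpret d: Vector_Spaces.linear scaleC "(*)" "dual n w j" by (rule linear_dual[OF w])
    have "dual n w j (v i) = (\<Sum>l = 1..n. a l i * dual n w j (w l))"
      unfolding a[OF that(1)] by (simp add: d.sum d.scale)
    also have "\<dots> = (\<Sum>l = 1..n. if l = j then a j i else 0)"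
      by (intro sum.cong refl) (use that in \<open>simp add: dual_basis[OF w]\<close>)
    finally show ?thesis using that by simp
  qed
  moreover have "R ! r \<in> {1..n}" if "r < length R" for r
    using that assms(3) nth_mem by blast
  moreover have "C ! c \<in> {1..n}" if "c < length C" for c
    using that assms(4) nth_mem by blast
  ultimately show ?thesis
    unfolding wedge_def using assms(5) by (auto intro!: arg_cong[of _ _ det] eq_matI)
qed

text \<open>If \<open>L\<close> is not inside \<open>I\<close>, a row of \<open>L\<close> vanishes,
  matching the convention of \<open>minor_minus\<close>. Otherwise the rows of \<open>L\<close> are
  expanded away, and the remaining columns are vectors fixed by \<open>T\<close>, so the composition
  with \<open>T\<close> drops out.\<close>

lemma wedge_circ_forms:
  assumes w: "is_basis n w" and v: "is_basis n v"
    and \<eta>: "\<And>i. i \<in> {1..n} \<Longrightarrow> T (v i) = \<eta> i *\<^sub>C v i"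
    and a: "\<And>i. i \<in> {1..n} \<Longrightarrow> v i = (\<Sum>j = 1..n. a j i *\<^sub>C w j)"
    and J: "J \<in> increasing n p" and L: "L \<in> increasing n q" and I: "I \<in> increasing n (p + q - 1)"
    and k: "k \<in> {1..p}" and support: "{i \<in> {1..n}. \<eta> i \<noteq> 1} \<subseteq> set L"
    and lam: "set L \<subseteq> set I \<Longrightarrow> \<forall>s\<in>{1..q}. lam s \<in> {1..p + q - 1} \<and> L ! (s - 1) = I ! (lam s - 1)"
  shows "(-1) powi ((int q - 1) * (int k - 1)) * wedge (circ_forms n T w v J L k) (map v I)
    = (-1) powi (1 - int q - int k + (\<Sum>s = 1..q. int (lam s)) - int (q choose 2))
      * minor_minus a (take (k - 1) J @ drop k J) I L"
proof (cases "set L \<subseteq> set I")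
  case False
  then obtain l where l: "l \<in> set L" "l \<notin> set I" by blast
  have "wedge (circ_forms n T w v J L k) (map v I) = 0"
  proof (rule wedge_row_zero)
    show "dual n v l \<in> set (circ_forms n T w v J L k)"
      using l by (simp add: circ_forms_def)
    fix y assume "y \<in> set (map v I)"
    then show "dual n v l y = 0"
      using l L I by (auto simp: increasing_def subset_iff dual_basis[OF v])
  qed
  then show ?thesis using False by (simp add: minor_minus_def)
next
  case True
  define C where "C = filter (\<lambda>i. i \<notin> set L) I"
  let ?J1 = "take (k - 1) J" and ?J2 = "drop k J"
  have facts: "length J = p" "length L = q" "length I = p + q - 1" "sorted_wrt (<) L" "sorted_wrt (<) I"
    "set I \<subseteq> {1..n}" "set J \<subseteq> {1..n}" "distinct L" "distinct I"
    using J L I by (auto simp: increasing_def strict_sorted_iff)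
  have C_set: "set C \<subseteq> {1..n}"
    using facts by (auto simp: C_def)
  have "length C = card (set I - set L)"
    using facts by (subst distinct_card[symmetric]) (auto simp: C_def set_diff_eq)
  \<comment> \<open>Since \<open>1 \<le> k \<le> p\<close>, the truncated subtraction in
    \<open>p + q - 1\<close> is exact.\<close>
  then have C_length: "length C = p - 1"
    using True facts k by (simp add: card_Diff_subset distinct_card)
  have J1_length: "length ?J1 = k - 1"
    using facts k by auto
  have R_length: "length (?J1 @ ?J2) = p - 1"
    using facts k by auto
  have R_set: "set (?J1 @ ?J2) \<subseteq> {1..n}"
    using facts by (auto dest: in_set_takeD in_set_dropD)
  have "wedge (circ_forms n T w v J L k) (map v I) =
      (-1) ^ (\<Sum>s<length L. length (map (dual n w) ?J1) + s + (lam (Suc s) - 1))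
      * wedge (map (dual n w) ?J1 @ map (\<lambda>j. dual n w j \<circ> T) ?J2) (map v C)"
    unfolding circ_forms_def C_def
  proof (rule wedge_dual_rows[OF v])
    \<comment> \<open>\<open>lam\<close> counts positions and arguments from 1, whereas
      \<open>wedge_dual_rows\<close> counts from 0; hence the shift to
      \<open>lam (Suc s) - 1\<close>.\<close>
    fix s assume "s < length L"
    then show "lam (Suc s) - 1 < length I \<and> I ! (lam (Suc s) - 1) = L ! s"
      using lam[OF True, rule_format, of "Suc s"] facts by auto
  qed (use facts in auto)
  also have "wedge (map (dual n w) ?J1 @ map (\<lambda>j. dual n w j \<circ> T) ?J2) (map v C)
      = wedge (map (dual n w) (?J1 @ ?J2)) (map v C)"
  proof (rule wedge_cong)
    fix r y
    assume r: "r < length (map (dual n w) ?J1 @ map (\<lambda>j. dual n w j \<circ> T) ?J2)" and "y \<in> set (map v C)"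
    then obtain i where i: "y = v i" "i \<in> set C" by auto
    then have "i \<in> {1..n}" "i \<notin> set L"
      using C_set by (auto simp: C_def)
    \<comment> \<open>An index outside \<open>L\<close> has eigenvalue 1 by
      \<open>support\<close>.\<close>
    then have "T y = y"
      using support \<eta>[of i] i by auto
    then show "((map (dual n w) ?J1 @ map (\<lambda>j. dual n w j \<circ> T) ?J2) ! r) y = (map (dual n w) (?J1 @ ?J2) ! r) y"
      using r by (auto simp: nth_append)
  qed simp
  also have "\<dots> = minor_minus a (?J1 @ ?J2) I L"
    using wedge_dual_eq_minor[OF w a R_set C_set] True R_length C_length
    by (simp add: minor_minus_def Let_def flip: C_def)
  finally have "wedge (circ_forms n T w v J L k) (map v I) =
      (-1) ^ (\<Sum>s<q. (k - 1) + s + (lam (Suc s) - 1)) * minor_minus a (?J1 @ ?J2) I L"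
    by (simp only: length_map J1_length facts(2))
  moreover have "(-1 :: complex) powi ((int q - 1) * (int k - 1)) * (-1) ^ (\<Sum>s<q. (k - 1) + s + (lam (Suc s) - 1))
    = (-1) powi (1 - int q - int k + (\<Sum>s = 1..q. int (lam s)) - int (q choose 2))"
    using k lam[OF True] by (intro laplace_sign) auto
  ultimately show ?thesis
    by (simp only: mult.assoc[symmetric])
qed

text \<open>The function \<lambda> appears as any \<open>lam\<close> with its defining property;
  where \<open>L\<close> is not contained in \<open>I\<close> it is arbitrary, and all minors are 0
  there. As \<open>u\<close> is an arbitrary basis, the formula also shows independence of the
  auxiliary basis.\<close>

theorem theorem7p2:
  fixes G :: "('g, 'b) monoid_scheme"
    and \<rho> :: "'g \<Rightarrow> 'v::complex_vector \<Rightarrow> 'v"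
    and ip :: "'v \<Rightarrow> 'v \<Rightarrow> complex"
    and g h :: 'g
    and n p q m :: nat
    and w v u :: "nat \<Rightarrow> 'v"
    and \<epsilon> :: "nat \<Rightarrow> complex"
    and a :: "nat \<Rightarrow> nat \<Rightarrow> complex"
    and f f' :: "'v sym_alg"
    and J L :: "nat list"
    and \<alpha> \<beta> :: "('g, 'v) cochain"
  assumes "group G" and "finite (carrier G)"
    and "CG_module G \<rho>"
    and "invariant_hermitian G \<rho> ip"
    and "g \<in> carrier G" and "h \<in> carrier G"
    and "is_eigenbasis n (\<rho> g) w"
    and "is_eigenbasis n (\<rho> h) v"
    and "is_basis n u"
    and "\<And>i. i \<in> {1..n} \<Longrightarrow> v i = (\<Sum>j = 1..n. a j i *\<^sub>C w j)"
    and "\<And>i. i \<in> {1..n} \<Longrightarrow> \<rho> g (w i) = \<epsilon> i *\<^sub>C w i"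
    and "J \<in> increasing n p" and "\<alpha> = tens g f (dform n w J)" and "\<alpha> \<in> H_cochains ip \<rho> p g"
    and "L \<in> increasing n q" and "\<beta> = tens h f' (dform n v L)" and "\<beta> \<in> H_cochains ip \<rho> q h"
    and "m = p + q - 1"
  shows "circ n G \<rho> g h w v u p q \<alpha> \<beta> \<in> cochains m (g \<otimes>\<^bsub>G\<^esub> h)
    \<and> (\<forall>I \<in> increasing n m. \<forall>lam :: nat \<Rightarrow> nat.
        (set L \<subseteq> set I \<longrightarrow> (\<forall>s\<in>{1..q}. lam s \<in> {1..m} \<and> L ! (s - 1) = I ! (lam s - 1))) \<longrightarrow>
        circ n G \<rho> g h w v u p q \<alpha> \<beta> (map v I) =
          (\<Sum>k = 1..p.
            let j = J ! (k - 1);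
                Jk = take (k - 1) J @ drop k J;
                \<nu> = 1 - int q - int k + (\<Sum>s = 1..q. int (lam s)) - int (q choose 2)
            in Poly_Mapping.single (g \<otimes>\<^bsub>G\<^esub> h)
                 (((-1) powi \<nu> * minor_minus a Jk I L) *\<^sub>C
                   (sym_map (slot_prod n w \<epsilon> j) (quantum_partial n w j (\<epsilon> j) f') * f))))"
proof -
  have w: "is_basis n w" and v: "is_basis n v"
    using assms(7,8) by (auto simp: is_eigenbasis_def)
  have T: "clinear (\<rho> h)"
    using assms(3,6) by (simp add: CG_module_def)
  obtain \<eta> where \<eta>: "\<And>i. i \<in> {1..n} \<Longrightarrow> \<rho> h (v i) = \<eta> i *\<^sub>C v i"
    using assms(8) unfolding is_eigenbasis_def by metis
  note J = \<open>J \<in> increasing n p\<close> and L = \<open>L \<in> increasing n q\<close> and \<epsilon> = assms(11)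
  let ?c = "\<lambda>k. (-1) powi ((int q - 1) * (int k - 1)) :: complex"
  let ?X = "\<lambda>k. slot_partial n w \<epsilon> (J ! (k - 1)) f' * f"
  let ?\<xi>s = "circ_forms n (\<rho> h) w v J L"
  have circ: "circ n G \<rho> g h w v u p q \<alpha> \<beta> =
      (\<lambda>ys. \<Sum>k = 1..p. tens (g \<otimes>\<^bsub>G\<^esub> h) (?c k *\<^sub>C ?X k) (wedge (?\<xi>s k)) ys)"
    unfolding assms(13,16) by (rule circ_tens[where \<rho> = \<rho>, OF w v \<open>is_basis n u\<close> T \<epsilon> \<eta> J L])
  have "circ n G \<rho> g h w v u p q \<alpha> \<beta> \<in> cochains m (g \<otimes>\<^bsub>G\<^esub> h)"
    unfolding circ cochains_def
  \<comment> \<open>Each summand is a single generator of the cochains, its sign absorbed into the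
    coefficient in \<open>S(V)\<close>.\<close>
  proof (rule sums_of_sum)
    fix k assume k: "k \<in> {1..p}"
    have "length (?\<xi>s k) = m"
      using k J L \<open>m = p + q - 1\<close> by (auto simp: circ_forms_def increasing_def)
    moreover have "set (?\<xi>s k) \<subseteq> functionals_vanishing_on {}"
      using linear_dual[OF w] linear_dual[OF v] Vector_Spaces.linear_compose[OF T linear_dual[OF w]]
      by (auto simp: circ_forms_def functionals_vanishing_on_def)
    ultimately show "tens (g \<otimes>\<^bsub>G\<^esub> h) (?c k *\<^sub>C ?X k) (wedge (?\<xi>s k)) \<in>
        {tens (g \<otimes>\<^bsub>G\<^esub> h) f (wedge \<xi>s) | f \<xi>s. length \<xi>s = m \<and> set \<xi>s \<subseteq> functionals_vanishing_on {}}"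
      by blast
  qed simp
  moreover have "circ n G \<rho> g h w v u p q \<alpha> \<beta> (map v I) =
      (\<Sum>k = 1..p.
        let j = J ! (k - 1);
            Jk = take (k - 1) J @ drop k J;
            \<nu> = 1 - int q - int k + (\<Sum>s = 1..q. int (lam s)) - int (q choose 2)
        in Poly_Mapping.single (g \<otimes>\<^bsub>G\<^esub> h)
             (((-1) powi \<nu> * minor_minus a Jk I L) *\<^sub>C
               (sym_map (slot_prod n w \<epsilon> j) (quantum_partial n w j (\<epsilon> j) f') * f)))"
    if I: "I \<in> increasing n m"
      and lam: "set L \<subseteq> set I \<longrightarrow> (\<forall>s\<in>{1..q}. lam s \<in> {1..m} \<and> L ! (s - 1) = I ! (lam s - 1))"
    for I and lam :: "nat \<Rightarrow> nat"
    unfolding circ Let_def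
  proof (rule sum.cong)
    fix k assume k: "k \<in> {1..p}"
    let ?\<nu> = "1 - int q - int k + (\<Sum>s = 1..q. int (lam s)) - int (q choose 2)"
    let ?d = "(-1) powi ?\<nu> * minor_minus a (take (k - 1) J @ drop k J) I L"
    have "(?c k * wedge (?\<xi>s k) (map v I)) *\<^sub>C ?X k = ?d *\<^sub>C ?X k"
    proof (cases "f' = 0")
      case True
      have "J ! (k - 1) \<in> {1..n}"
        using k by (intro increasing_nth_mem[OF J]) auto
      then have "slot_partial n w \<epsilon> (J ! (k - 1)) (0 *\<^sub>C f') = 0 *\<^sub>C slot_partial n w \<epsilon> (J ! (k - 1)) f'"
        by (rule slot_partial_scale[OF w])
      then have "?X k = 0" using True by simp
      then show ?thesis by simp
    next
      case False
      \<comment> \<open>The value at \<open>v\<^sub>L\<close> recovers the coefficient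
        \<open>f'\<close>, supplying the nonvanishing that forces the support of \<beta> into
        \<open>L\<close>.\<close>
      have "\<beta> (map v L) = Poly_Mapping.single h f'"
        unfolding assms(16) by (simp add: tens_def dform_basis[OF v L L])
      then have nonzero: "\<beta> (map v L) \<noteq> 0"
        using False by (metis lookup_single_eq lookup_zero)
      have "{i \<in> {1..n}. \<eta> i \<noteq> 1} \<subseteq> set L"
        by (rule H_cochains_support[OF v T \<eta> L assms(17) nonzero])
      then have "?c k * wedge (?\<xi>s k) (map v I) = ?d"
        using I lam k unfolding \<open>m = p + q - 1\<close>
        by (intro wedge_circ_forms[OF w v \<eta> assms(10) J L]) auto
      then show ?thesis by simp
    qed
    then show "tens (g \<otimes>\<^bsub>G\<^esub> h) (?c k *\<^sub>C ?X k) (wedge (?\<xi>s k)) (map v I) =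
        Poly_Mapping.single (g \<otimes>\<^bsub>G\<^esub> h) (?d *\<^sub>C
          (sym_map (slot_prod n w \<epsilon> (J ! (k - 1))) (quantum_partial n w (J ! (k - 1)) (\<epsilon> (J ! (k - 1))) f') * f))"
      unfolding tens_def scaleC_scaleC slot_partial_def by (simp only: mult.commute[of "wedge _ _"])
  qed simp
  ultimately show ?thesis by blast
qed

end
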